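(* Let $\alpha_1,\alpha_2,\beta_1,\beta_2>0$ and $\lambda\in\mathbb{R}$. Write $f(t)=t^{\beta_1-1}E_{(\alpha_1,\beta_1),(\alpha_2,\beta_2)}(\lambda t^{\alpha_1})$ for $t>0$. Then for all $s\in\mathbb{C}$ with $\mathrm{Re}\,s>0$, $$\mathcal{L}\left(\frac{\partial f}{\partial\alpha_1}\right)(s)=-\frac{\ln s}{s^{\beta_1}}\sum_{k=0}^{\infty}\frac{k(\lambda s^{-\alpha_1})^k}{\Gamma(\alpha_2k+\beta_2)},$$ $$\mathcal{L}\left(\frac{\partial f}{\partial\beta_1}\right)(s)=-\frac{\ln s}{s^{\beta_1}}\,E_{\alpha_2,\beta_2}(\lambda s^{-\alpha_1}),$$ $$\mathcal{L}\left(\frac{\partial f}{\partial\alpha_2}\right)(s)=-\frac{1}{s^{\beta_1}}\sum_{k=0}^{\infty}\frac{k\,\psi(\alpha_2k+\beta_2)}{\Gamma(\alpha_2k+\beta_2)}(\lambda s^{-\alpha_1})^k,$$ $$\mathcal{L}\left(\frac{\partial f}{\partial\beta_2}\right)(s)=-\frac{1}{s^{\beta_1}}\sum_{k=0}^{\infty}\frac{\psi(\alpha_2k+\beta_2)}{\Gamma(\alpha_2k+\beta_2)}(\lambda s^{-\alpha_1})^k.$$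
   Context: $E_{(\alpha_1,\beta_1),(\alpha_2,\beta_2)}(z)=\sum_{k=0}^{\infty}\frac{z^k}{\Gamma(\alpha_1k+\beta_1)\Gamma(\alpha_2k+\beta_2)}$ is the four-parametric Mittag-Leffler function and $E_{\alpha,\beta}(z)=\sum_{k=0}^{\infty}\frac{z^k}{\Gamma(\alpha k+\beta)}$ the two-parametric one. $\psi=\Gamma'/\Gamma$ is the digamma function. The convention $0^0=1$ is used. The Laplace transform acts in the variable $t>0$: $\mathcal{L}(f(t))(s)=\int_0^\infty e^{-st}f(t)\,dt$. Powers of $s$ and $\ln s$ are principal branches. *)

theory Defs
  imports "HOL-Analysis.Analysis"
begin

text \<open>
  The parameters are real, and the argument may be real or complex, because both kinds of
  argument are needed. Powers use \<open>0 ^ 0 = 1\<close>.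
\<close>

definition mittag_leffler ::
    "real \<Rightarrow> real \<Rightarrow> 'a::{real_normed_field,banach} \<Rightarrow> 'a" where
  "mittag_leffler \<alpha> \<beta> z = (\<Sum>k. z ^ k / of_real (Gamma (\<alpha> * real k + \<beta>)))"

definition mittag_leffler4 ::
    "real \<Rightarrow> real \<Rightarrow> real \<Rightarrow> real \<Rightarrow> 'a::{real_normed_field,banach} \<Rightarrow> 'a" where
  "mittag_leffler4 \<alpha>\<^sub>1 \<beta>\<^sub>1 \<alpha>\<^sub>2 \<beta>\<^sub>2 z =
     (\<Sum>k. z ^ k / of_real (Gamma (\<alpha>\<^sub>1 * real k + \<beta>\<^sub>1) * Gamma (\<alpha>\<^sub>2 * real k + \<beta>\<^sub>2)))"

text \<open>The following function is only meaningful for \<open>t > 0\<close>.\<close>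

definition ml_fun :: "real \<Rightarrow> real \<Rightarrow> real \<Rightarrow> real \<Rightarrow> real \<Rightarrow> real \<Rightarrow> real" where
  "ml_fun l \<alpha>\<^sub>1 \<beta>\<^sub>1 \<alpha>\<^sub>2 \<beta>\<^sub>2 t =
     t powr (\<beta>\<^sub>1 - 1) * mittag_leffler4 \<alpha>\<^sub>1 \<beta>\<^sub>1 \<alpha>\<^sub>2 \<beta>\<^sub>2 (l * t powr \<alpha>\<^sub>1)"

text \<open>
  The transform is a Lebesgue integral, whose value is 0 by convention if the integrand is
  not integrable; the predicate \<open>laplace_exists\<close> rules this case out.
\<close>

definition laplace_exists :: "(real \<Rightarrow> real) \<Rightarrow> complex \<Rightarrow> bool" where
  "laplace_exists f s \<longleftrightarrow>
     set_integrable lborel {0<..} (\<lambda>t. exp (- s * of_real t) * complex_of_real (f t))"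

definition laplace :: "(real \<Rightarrow> real) \<Rightarrow> complex \<Rightarrow> complex" where
  "laplace f s = (LINT t:{0<..}|lborel. exp (- s * of_real t) * complex_of_real (f t))"

end

theory Submission
  imports Defs
begin

text \<open>
  The function \<open>ml_fun l \<alpha>\<^sub>1 \<beta>\<^sub>1 \<alpha>\<^sub>2 \<beta>\<^sub>2\<close> is the series over \<open>k\<close> of
  \<open>l ^ k / Gamma (\<alpha>\<^sub>2 * k + \<beta>\<^sub>2)\<close> times the kernel \<open>t powr (x - 1) / Gamma x\<close> at
  \<open>x = \<alpha>\<^sub>1 * k + \<beta>\<^sub>1\<close>. The Laplace transform of the kernel is \<open>s powr (- x)\<close>, so the transform of its
  derivative with respect to \<open>x\<close> is \<open>- Ln s * s powr (- x)\<close>. If the series may be differentiated in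
  a parameter and transformed term by term, then the four formulas follow: a derivative in \<open>\<alpha>\<^sub>1\<close> or
  \<open>\<beta>\<^sub>1\<close> acts on the kernel and yields the factor \<open>- Ln s\<close>, and a derivative in \<open>\<alpha>\<^sub>2\<close> or
  \<open>\<beta>\<^sub>2\<close> acts on \<open>1 / Gamma\<close> and yields the digamma function; in both cases an \<open>\<alpha>\<close> contributes
  an inner derivative \<open>k\<close>.
  
  Both interchanges rest on one estimate. The inequality \<open>1 / Gamma x \<le> x * exp M * M powr (- x)\<close>
  (\<open>inverse_Gamma_le\<close>) holds for every positive \<open>M\<close>, so reciprocal Gamma values, even after
  differentiation, decay faster than every exponential, whereas everything else in the terms grows at
  most exponentially in \<open>k\<close>. This gives the Weierstrass test for
  \<open>rl_kernel_series_has_derivative\<close> and the summability of the absolute integrals in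
  \<open>laplace_series\<close>.
  
  The transform of the kernel for complex \<open>s\<close> (\<open>laplace_powr\<close>) comes from the real Gamma integral
  by the binomial series around a suitable real point. The transform of its derivative
  (\<open>laplace_powr_ln\<close>) comes from it by dominated convergence of difference quotients.
\<close>

section \<open>Sequences of exponential growth and of superexponential decay\<close>

text \<open>
  Coefficients such as \<open>l ^ k\<close>, \<open>k\<close>, \<open>\<sigma> powr (- (\<alpha> * k + \<beta>))\<close> and the integrals
  of the absolute values of the kernels below grow at most exponentially in \<open>k\<close>, at a rate that
  depends on the parameters. The reciprocal Gamma values decay faster than every exponential, so they absorb any
  product of such factors; these two predicates keep the rates out of most arguments.
\<close>

definition exp_bounded :: "(nat \<Rightarrow> real) \<Rightarrow> bool" where
  "exp_bounded v \<longleftrightarrow> (\<exists>A q. \<forall>k. \<bar>v k\<bar> \<le> A * exp (q * real k))"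

definition superexp_small :: "(nat \<Rightarrow> real) \<Rightarrow> bool" where
  "superexp_small u \<longleftrightarrow> (\<forall>m. \<exists>A. \<forall>k. \<bar>u k\<bar> \<le> A * exp (- m * real k))"

lemma superexp_small_mult:
  assumes "exp_bounded v" "superexp_small u"
  shows "superexp_small (\<lambda>k. v k * u k)"
  unfolding superexp_small_def
proof
  fix m :: real
  obtain A q where v: "\<And>k. \<bar>v k\<bar> \<le> A * exp (q * real k)"
    using assms(1) unfolding exp_bounded_def by blast
  obtain B where u: "\<And>k. \<bar>u k\<bar> \<le> B * exp (- (m + q) * real k)"
    using assms(2) unfolding superexp_small_def by blast
  have "\<bar>v k * u k\<bar> \<le> (A * B) * exp (- m * real k)" for k
  proof -
    have "\<bar>v k * u k\<bar> \<le> (A * exp (q * real k)) * (B * exp (- (m + q) * real k))"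
      unfolding abs_mult using v[of k] u[of k] by (intro mult_mono) (auto intro: order_trans[OF abs_ge_zero])
    also have "\<dots> = (A * B) * (exp (q * real k) * exp (- (m + q) * real k))"
      by simp
    also have "exp (q * real k) * exp (- (m + q) * real k) = exp (- m * real k)"
      by (simp add: exp_add[symmetric] algebra_simps)
    finally show ?thesis .
  qed
  then show "\<exists>A. \<forall>k. \<bar>v k * u k\<bar> \<le> A * exp (- m * real k)" by blast
qed

lemma superexp_small_imp_exp_bounded: "superexp_small u \<Longrightarrow> exp_bounded u"
  unfolding superexp_small_def exp_bounded_def by blast

lemma summable_exp_decay: "summable (\<lambda>k. A * exp (- real k))"
proof -
  have "(\<lambda>k. A * exp (- real k)) = (\<lambda>k. A * exp (- 1) ^ k)"
    by (simp add: exp_of_nat_mult[symmetric])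
  then show ?thesis
    by (simp add: summable_mult summable_geometric)
qed

lemma superexp_small_summable:
  assumes "superexp_small u"
  shows "summable (\<lambda>k. \<bar>u k\<bar>)"
proof -
  obtain A where "\<And>k. \<bar>u k\<bar> \<le> A * exp (- 1 * real k)"
    using assms unfolding superexp_small_def by blast
  then show ?thesis
    by (intro summable_comparison_test'[OF summable_exp_decay[of A]]) auto
qed

lemma exp_bounded_mult:
  assumes "exp_bounded u" "exp_bounded v"
  shows "exp_bounded (\<lambda>k. u k * v k)"
proof -
  obtain A q where u: "\<And>k. \<bar>u k\<bar> \<le> A * exp (q * real k)"
    using assms(1) unfolding exp_bounded_def by blast
  obtain B r where v: "\<And>k. \<bar>v k\<bar> \<le> B * exp (r * real k)"
    using assms(2) unfolding exp_bounded_def by blast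
  have "\<bar>u k * v k\<bar> \<le> (A * B) * exp ((q + r) * real k)" for k
  proof -
    have "\<bar>u k * v k\<bar> \<le> (A * exp (q * real k)) * (B * exp (r * real k))"
      unfolding abs_mult using u[of k] v[of k] by (intro mult_mono) (auto intro: order_trans[OF abs_ge_zero])
    also have "\<dots> = (A * B) * exp ((q + r) * real k)"
      by (simp add: exp_add algebra_simps)
    finally show ?thesis .
  qed
  then show ?thesis unfolding exp_bounded_def by blast
qed

lemma exp_bounded_power: "exp_bounded (\<lambda>k. r ^ k)"
  unfolding exp_bounded_def
proof (intro exI allI)
  fix k :: nat
  have "\<bar>r\<bar> \<le> exp \<bar>r\<bar>" using exp_ge_add_one_self[of "\<bar>r\<bar>"] by linarith
  then have "\<bar>r\<bar> ^ k \<le> exp \<bar>r\<bar> ^ k" by (intro power_mono) auto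
  then show "\<bar>r ^ k\<bar> \<le> 1 * exp (\<bar>r\<bar> * real k)"
    by (simp add: power_abs exp_of_nat_mult[symmetric] mult.commute)
qed

lemma exp_bounded_of_nat: "exp_bounded (\<lambda>k. real k)"
  unfolding exp_bounded_def
proof (intro exI allI)
  fix k :: nat
  show "\<bar>real k\<bar> \<le> 1 * exp (1 * real k)"
    using exp_ge_add_one_self[of "real k"] by (simp, linarith)
qed

lemma exp_bounded_const: "exp_bounded (\<lambda>k. c)"
  unfolding exp_bounded_def by (intro exI[of _ "\<bar>c\<bar>"] exI[of _ 0]) simp

lemma exp_bounded_exp: "exp_bounded (\<lambda>k. A * exp (q * (\<alpha> * real k + \<beta>)))"
  unfolding exp_bounded_def
  by (intro exI[of _ "\<bar>A\<bar> * exp (q * \<beta>)"] exI[of _ "q * \<alpha>"])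
     (simp add: abs_mult exp_add[symmetric] algebra_simps)

lemma exp_bounded_add:
  assumes "exp_bounded u" "exp_bounded v"
  shows "exp_bounded (\<lambda>k. u k + v k)"
proof -
  obtain A q where u: "\<And>k. \<bar>u k\<bar> \<le> A * exp (q * real k)"
    using assms(1) unfolding exp_bounded_def by blast
  obtain B r where v: "\<And>k. \<bar>v k\<bar> \<le> B * exp (r * real k)"
    using assms(2) unfolding exp_bounded_def by blast
  have AB: "A \<ge> 0" "B \<ge> 0" using u[of 0] v[of 0] by auto
  have "\<bar>u k + v k\<bar> \<le> (A + B) * exp (max q r * real k)" for k
  proof -
    have "A * exp (q * real k) \<le> A * exp (max q r * real k)"
      "B * exp (r * real k) \<le> B * exp (max q r * real k)"
      using AB by (auto intro!: mult_left_mono mult_right_mono)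
    then show ?thesis using u[of k] v[of k] by (simp add: distrib_right)
  qed
  then show ?thesis unfolding exp_bounded_def by blast
qed

lemma exp_bounded_powr:
  assumes "\<sigma> > 0"
  shows "exp_bounded (\<lambda>k. \<sigma> powr (- (\<alpha> * real k + \<beta>)))"
  using exp_bounded_exp[of 1 "- ln \<sigma>" \<alpha> \<beta>] assms by (simp add: powr_def algebra_simps)

lemma exp_bounded_affine: "exp_bounded (\<lambda>k. \<alpha> * real k + \<beta>)"
  by (intro exp_bounded_add exp_bounded_mult exp_bounded_const exp_bounded_of_nat)

lemma exp_bounded_mono:
  assumes "exp_bounded v" "\<And>k. \<bar>u k\<bar> \<le> v k"
  shows "exp_bounded u"
proof -
  obtain A q where "\<And>k. \<bar>v k\<bar> \<le> A * exp (q * real k)"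
    using assms(1) unfolding exp_bounded_def by blast
  then have "\<bar>u k\<bar> \<le> A * exp (q * real k)" for k
    using assms(2)[of k] by (meson abs_ge_self order_trans)
  then show ?thesis unfolding exp_bounded_def by blast
qed

section \<open>Decay of the reciprocal Gamma function\<close>

lemma pos_not_in_nonpos_Ints: "x > (0::real) \<Longrightarrow> x \<notin> \<int>\<^sub>\<le>\<^sub>0"
  by (auto elim!: nonpos_Ints_cases)

text \<open>
  On \<open>{M..}\<close> the integrand \<open>t powr x * exp (- t)\<close> of \<open>Gamma (x + 1)\<close> is at least
  \<open>M powr x * exp (- t)\<close>, and the latter integrates to the bound.
\<close>
lemma Gamma_plus1_ge:
  fixes x M :: real
  assumes "x > 0" "M > 0"
  shows "Gamma (x + 1) \<ge> M powr x * exp (- M)"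
proof -
  let ?g = "\<lambda>t. if t \<in> {M..} then M powr x * exp (- t) else 0"
  have "((\<lambda>t. exp (- 1 * t)) has_integral exp (- 1 * M) / 1) {M..}"
    by (rule has_integral_exp_minus_to_infinity) simp
  then have "((\<lambda>t. M powr x * exp (- t)) has_integral M powr x * exp (- M)) {M..}"
    by (intro has_integral_mult_right) simp
  then have 1: "(?g has_integral M powr x * exp (- M)) {0..}"
    using assms by (subst has_integral_restrict) auto
  have 2: "((\<lambda>t. t powr (x + 1 - 1) / exp t) has_integral Gamma (x + 1)) {0..}"
    using assms by (intro Gamma_integral_real) simp
  show ?thesis
  proof (rule has_integral_le[OF 1 2])
    fix t :: real assume "t \<in> {0..}"
    then show "?g t \<le> t powr (x + 1 - 1) / exp t"
      using assms by (auto simp: exp_minus divide_inverse intro!: mult_right_mono powr_mono2)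
  qed
qed

text \<open>
  Since \<open>M\<close> is arbitrary, \<open>1 / Gamma x\<close> decays faster than every exponential, with explicit
  constants that are valid on the whole positive axis. Stirling's formula would give a sharper rate,
  but only asymptotically.
\<close>
lemma inverse_Gamma_le:
  fixes x M :: real
  assumes "x > 0" "M > 0"
  shows "1 / Gamma x \<le> x * exp M * M powr (- x)"
proof -
  have "M powr x * exp (- M) \<le> x * Gamma x"
    using Gamma_plus1_ge[OF assms] Gamma_plus1[OF pos_not_in_nonpos_Ints[OF assms(1)]] by simp
  then have "1 \<le> x * Gamma x * (exp M * M powr (- x))"
    using assms by (simp add: exp_minus powr_minus field_simps)
  then show ?thesis
    using assms by (simp add: field_simps)
qed

lemma ln_le_self: "t > 0 \<Longrightarrow> ln t \<le> (t::real)"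
  using ln_le_minus_one[of t] by linarith

text \<open>
  By the mean value theorem and the functional equation, \<open>ln x = ln_Gamma (x + 1) - ln_Gamma x\<close> is a
  value of the digamma function to the right of \<open>x\<close>, and the digamma function is increasing.
\<close>
lemma Digamma_le:
  assumes "x > (0::real)"
  shows "Digamma x \<le> x"
proof -
  have "\<exists>z. x < z \<and> z < x + 1 \<and> ln_Gamma (x + 1) - ln_Gamma x = (x + 1 - x) * Digamma z"
    using assms by (intro MVT2) (auto intro!: derivative_eq_intros elim!: nonpos_Ints_cases)
  then obtain z where z: "x < z" "ln_Gamma (x + 1) - ln_Gamma x = Digamma z" by auto
  have "ln_Gamma (x + 1) = ln x + ln_Gamma x"
    using assms Gamma_real_pos[OF assms, THEN less_imp_neq, symmetric]
    by (simp add: ln_Gamma_real_pos Gamma_plus1 pos_not_in_nonpos_Ints ln_mult)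
  then have "Digamma z = ln x" using z by simp
  moreover have "Digamma x \<le> Digamma z" using assms z by (intro Digamma_real_mono) auto
  ultimately show ?thesis using ln_le_self[OF assms] by linarith
qed

lemma abs_Digamma_le:
  assumes "x\<^sub>0 > 0" "x\<^sub>0 \<le> (x::real)"
  shows "\<bar>Digamma x\<bar> \<le> \<bar>Digamma x\<^sub>0\<bar> + x"
  using Digamma_le[of x] Digamma_real_mono[of x\<^sub>0 x] assms by linarith

section \<open>Series of Riemann-Liouville kernels and their derivatives in the parameter\<close>

text \<open>
  The kernel of the Riemann-Liouville fractional integral, normalised so that its Laplace transform is
  \<open>s powr (- x)\<close>. For \<open>t = 1\<close> it is the reciprocal Gamma function, so one differentiation
  theorem covers both pairs of parameters.
\<close>
definition rl_kernel :: "real \<Rightarrow> real \<Rightarrow> real" where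
  "rl_kernel t x = t powr (x - 1) / Gamma x"

text \<open>The derivative of the kernel with respect to its order \<open>x\<close>.\<close>
definition rl_kernel_deriv :: "real \<Rightarrow> real \<Rightarrow> real" where
  "rl_kernel_deriv t x = rl_kernel t x * (ln t - Digamma x)"

lemma rl_kernel_has_derivative:
  assumes "t > 0" "x > 0"
  shows "(rl_kernel t has_field_derivative rl_kernel_deriv t x) (at x within S)"
proof -
  have "((\<lambda>x. t powr (x - 1) / Gamma x) has_field_derivative
          (ln t * t powr (x - 1) * Gamma x - t powr (x - 1) * (Gamma x * Digamma x)) /
            (Gamma x * Gamma x)) (at x within S)"
    using assms Gamma_real_pos[OF assms(2), THEN less_imp_neq, symmetric]
    by (auto intro!: derivative_eq_intros simp: powr_def pos_not_in_nonpos_Ints)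
  then show ?thesis
    using Gamma_real_pos[OF assms(2), THEN less_imp_neq, symmetric]
    by (simp add: rl_kernel_def[abs_def] rl_kernel_deriv_def diff_divide_distrib right_diff_distrib mult.commute)
qed

text \<open>
  The factor \<open>t powr (x - 1)\<close> costs an exponential in \<open>x\<close>, and \<open>ln t - Digamma x\<close> costs a
  factor that is linear in \<open>x\<close>. Both are dominated by the bound for \<open>1 / Gamma x\<close> with a large
  enough \<open>M = exp K\<close>.
\<close>
lemma rl_kernel_decay:
  assumes "t > 0" "x\<^sub>0 > 0"
  obtains C where "\<And>x. x \<ge> x\<^sub>0 \<Longrightarrow> \<bar>rl_kernel t x\<bar> \<le> C * exp (- m * x)"
    and "\<And>x. x \<ge> x\<^sub>0 \<Longrightarrow> \<bar>rl_kernel_deriv t x\<bar> \<le> C * exp (- m * x)"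
proof -
  define L where "L = \<bar>ln t\<bar>"
  \<comment> \<open>The rate \<open>K\<close> pays for \<open>exp (x * L)\<close>, for \<open>x * (1 + x) \<le> exp (2 * x)\<close> and for the
       desired decay.\<close>
  define K where "K = L + 2 + \<bar>m\<bar>"
  define P where "P = 1 + L + \<bar>Digamma x\<^sub>0\<bar>"
  define C where "C = exp L * exp (exp K) * P"
  have main: "rl_kernel t x * (1 + \<bar>ln t - Digamma x\<bar>) \<le> C * exp (- m * x)" if "x \<ge> x\<^sub>0" for x
  proof -
    have x: "x > 0" using that assms by simp
    have "t powr (x - 1) = exp ((x - 1) * ln t)"
      using assms by (simp add: powr_def)
    also have "(x - 1) * ln t \<le> \<bar>x - 1\<bar> * L"
      unfolding L_def by (metis abs_ge_self abs_mult)
    also have "\<dots> \<le> (x + 1) * L"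
      using x by (intro mult_right_mono) (auto simp: L_def)
    finally have t: "t powr (x - 1) \<le> exp ((x + 1) * L)" by simp
    have G: "1 / Gamma x \<le> x * exp (exp K) * exp (- K * x)"
      using inverse_Gamma_le[OF x, of "exp K"] by (simp add: powr_def mult.commute)
    have "\<bar>ln t - Digamma x\<bar> \<le> L + \<bar>Digamma x\<^sub>0\<bar> + x"
      using abs_Digamma_le[OF assms(2) that] unfolding L_def by linarith
    also have "\<dots> \<le> P * (1 + x) - 1"
      using x unfolding P_def L_def by (simp add: algebra_simps)
    finally have D: "1 + \<bar>ln t - Digamma x\<bar> \<le> P * (1 + x)" by simp
    have e: "x * (1 + x) \<le> exp x * exp x"
      using exp_ge_add_one_self[of x] x by (intro mult_mono) linarith+
    have "rl_kernel t x * (1 + \<bar>ln t - Digamma x\<bar>) =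
            t powr (x - 1) * (1 / Gamma x) * (1 + \<bar>ln t - Digamma x\<bar>)"
      by (simp add: rl_kernel_def)
    also have "\<dots> \<le> exp ((x + 1) * L) * (x * exp (exp K) * exp (- K * x)) * (P * (1 + x))"
      using t G D x Gamma_real_pos[OF x] by (intro mult_mono) auto
    also have "\<dots> = C * (exp (x * L) * exp (- K * x)) * (x * (1 + x))"
      by (simp add: C_def exp_add algebra_simps)
    also have "\<dots> \<le> C * (exp (x * L) * exp (- K * x)) * (exp x * exp x)"
      using e by (intro mult_left_mono) (auto simp: C_def P_def L_def)
    also have "\<dots> = C * exp (- \<bar>m\<bar> * x)"
      by (simp add: exp_add[symmetric] K_def algebra_simps)
    also have "\<dots> \<le> C * exp (- m * x)"
      using x by (intro mult_left_mono) (auto simp: C_def P_def L_def abs_if)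
    finally show ?thesis .
  qed
  have pos: "rl_kernel t x \<ge> 0" if "x \<ge> x\<^sub>0" for x
    using that assms Gamma_real_pos[of x] by (auto simp: rl_kernel_def)
  show thesis
  proof (rule that)
    fix x assume x: "x \<ge> x\<^sub>0"
    have "rl_kernel t x * 1 \<le> rl_kernel t x * (1 + \<bar>ln t - Digamma x\<bar>)"
      using pos[OF x] by (intro mult_left_mono) auto
    then show "\<bar>rl_kernel t x\<bar> \<le> C * exp (- m * x)"
      using main[OF x] pos[OF x] by linarith
    have "rl_kernel t x * \<bar>ln t - Digamma x\<bar> \<le> rl_kernel t x * (1 + \<bar>ln t - Digamma x\<bar>)"
      using pos[OF x] by (intro mult_left_mono) auto
    then show "\<bar>rl_kernel_deriv t x\<bar> \<le> C * exp (- m * x)"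
      using main[OF x] pos[OF x] by (simp add: rl_kernel_deriv_def abs_mult)
  qed
qed

lemma superexp_small_rl_kernel:
  assumes "t > 0" "\<alpha> > 0" "\<beta> > 0"
  shows "superexp_small (\<lambda>k. rl_kernel t (\<alpha> * real k + \<beta>))"
    and "superexp_small (\<lambda>k. rl_kernel_deriv t (\<alpha> * real k + \<beta>))"
proof -
  have "(\<exists>A. \<forall>k. \<bar>rl_kernel t (\<alpha> * real k + \<beta>)\<bar> \<le> A * exp (- m * real k)) \<and>
        (\<exists>A. \<forall>k. \<bar>rl_kernel_deriv t (\<alpha> * real k + \<beta>)\<bar> \<le> A * exp (- m * real k))" for m
  proof -
    obtain C where C: "\<And>x. x \<ge> \<beta> \<Longrightarrow> \<bar>rl_kernel t x\<bar> \<le> C * exp (- (m / \<alpha>) * x)"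
      "\<And>x. x \<ge> \<beta> \<Longrightarrow> \<bar>rl_kernel_deriv t x\<bar> \<le> C * exp (- (m / \<alpha>) * x)"
      using rl_kernel_decay[OF assms(1,3)] by blast
    have e: "C * exp (- (m / \<alpha>) * (\<alpha> * real k + \<beta>)) = (C * exp (- (m / \<alpha>) * \<beta>)) * exp (- m * real k)" for k
      using assms by (simp add: exp_add[symmetric] algebra_simps)
    show ?thesis
      using C(1,2)[of "\<alpha> * real _ + \<beta>"] assms unfolding e by (intro conjI; intro exI allI) auto
  qed
  then show "superexp_small (\<lambda>k. rl_kernel t (\<alpha> * real k + \<beta>))"
    and "superexp_small (\<lambda>k. rl_kernel_deriv t (\<alpha> * real k + \<beta>))"
    unfolding superexp_small_def by auto
qed

text \<open>
  Varying \<open>\<alpha>\<close> shifts the \<open>k\<close>-th order with slope \<open>k\<close>, and varying \<open>\<beta>\<close> shifts it with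
  slope \<open>1\<close>; the slopes \<open>n k\<close> treat both at once. The series of derivatives converges uniformly
  near \<open>p\<^sub>0\<close> by the Weierstrass test, because the orders stay above half of their values at
  \<open>p\<^sub>0\<close> there and the derivatives of the kernel decay superexponentially in the order.
\<close>
lemma rl_kernel_series_has_derivative:
  fixes c n :: "nat \<Rightarrow> real"
  assumes t: "t > 0" and \<alpha>: "\<alpha> > 0" and \<beta>: "\<beta> > 0" and c: "exp_bounded c"
    and n: "\<And>k. 0 \<le> n k" "\<And>k. n k \<le> real k + 1"
  shows "((\<lambda>p. \<Sum>k. c k * rl_kernel t (\<alpha> * real k + \<beta> + n k * (p - p\<^sub>0)))
          has_field_derivative (\<Sum>k. c k * (n k * rl_kernel_deriv t (\<alpha> * real k + \<beta>)))) (at p\<^sub>0)"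
proof -
  define x where "x k p = \<alpha> * real k + \<beta> + n k * (p - p\<^sub>0)" for k p
  \<comment> \<open>Slopes up to \<open>k + 1\<close> and steps up to \<open>\<delta>\<close> change the order \<open>\<alpha> * k + \<beta>\<close> by at most
       \<open>(k + 1) * \<delta>\<close>, which is at most half of it.\<close>
  define \<delta> where "\<delta> = min \<alpha> \<beta> / 2"
  have \<delta>: "\<delta> > 0" using \<alpha> \<beta> by (simp add: \<delta>_def)
  define S where "S = {p\<^sub>0 - \<delta>..p\<^sub>0 + \<delta>}"
  have x_ge: "x k p \<ge> (\<alpha> * real k + \<beta>) / 2" if "p \<in> S" for k p
  proof -
    have "n k * (p\<^sub>0 - p) \<le> n k * \<delta>"
      using that n by (intro mult_left_mono) (auto simp: S_def)
    also have "\<dots> \<le> (real k + 1) * \<delta>"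
      using n \<delta> by (intro mult_right_mono) auto
    also have "\<dots> \<le> real k * (\<alpha> / 2) + \<beta> / 2"
    proof -
      have "real k * \<delta> \<le> real k * (\<alpha> / 2)" "\<delta> \<le> \<beta> / 2"
        by (auto simp: \<delta>_def intro!: mult_left_mono)
      then show ?thesis by (simp add: algebra_simps)
    qed
    finally show ?thesis by (simp add: x_def field_simps)
  qed
  have x_ge': "x k p \<ge> \<beta> / 2" if "p \<in> S" for k p
  proof -
    have "\<alpha> * real k \<ge> 0" using \<alpha> by simp
    then show ?thesis using x_ge[OF that, of k] by (simp add: add_divide_distrib)
  qed
  have "exp_bounded (\<lambda>k. c k * (real k + 1))"
  proof (rule exp_bounded_mult[OF c])
    show "exp_bounded (\<lambda>k. real k + 1)"
      unfolding exp_bounded_def using exp_ge_add_one_self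
      by (intro exI[of _ 1]) (auto simp: add.commute)
  qed
  then obtain A q where A: "\<And>k. \<bar>c k * (real k + 1)\<bar> \<le> A * exp (q * real k)"
    unfolding exp_bounded_def by blast
  \<comment> \<open>At orders of at least \<open>\<alpha> * k / 2\<close>, decay with rate \<open>m\<close> gives \<open>exp (- (\<bar>q\<bar> + 1) * k)\<close>,
       which beats the coefficients with a factor \<open>exp (- k)\<close> to spare.\<close>
  define m where "m = 2 * (\<bar>q\<bar> + 1) / \<alpha>"
  have m: "m > 0" using \<alpha> by (simp add: m_def)
  obtain C where C: "\<And>x. x \<ge> \<beta> / 2 \<Longrightarrow> \<bar>rl_kernel_deriv t x\<bar> \<le> C * exp (- m * x)"
    using rl_kernel_decay[OF t half_gt_zero[OF \<beta>], of m] by blast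
  have C0: "C \<ge> 0"
    using C[of "\<beta> / 2"] by (smt (verit) exp_gt_zero mult_neg_pos order_refl)
  have bound: "norm (c k * (n k * rl_kernel_deriv t (x k p))) \<le> A * C * exp (- real k)"
    if "p \<in> S" for k p
  proof -
    have "norm (c k * (n k * rl_kernel_deriv t (x k p))) =
            \<bar>c k\<bar> * n k * \<bar>rl_kernel_deriv t (x k p)\<bar>"
      using n by (simp add: abs_mult)
    also have "\<dots> \<le> \<bar>c k\<bar> * (real k + 1) * (C * exp (- m * x k p))"
      using n C[OF x_ge'[OF that]] by (intro mult_mono) auto
    also have "\<dots> \<le> (A * exp (q * real k)) * (C * exp (- (\<bar>q\<bar> + 1) * real k))"
    proof (rule mult_mono)
      show "\<bar>c k\<bar> * (real k + 1) \<le> A * exp (q * real k)"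
        using A[of k] by (simp add: abs_mult)
      then show "0 \<le> A * exp (q * real k)"
        by (rule order_trans[rotated]) simp
      have "m * x k p \<ge> m * ((\<alpha> * real k + \<beta>) / 2)"
        using x_ge[OF that] m by (intro mult_left_mono) auto
      also have "m * ((\<alpha> * real k + \<beta>) / 2) \<ge> (\<bar>q\<bar> + 1) * real k"
        using \<alpha> \<beta> m by (simp add: m_def field_simps)
      finally show "C * exp (- m * x k p) \<le> C * exp (- (\<bar>q\<bar> + 1) * real k)"
        using C0 by (intro mult_left_mono) (simp_all add: algebra_simps)
    qed (use C0 in auto)
    also have "\<dots> = A * C * exp ((q - \<bar>q\<bar>) * real k - real k)"
      by (simp add: exp_add[symmetric] algebra_simps)
    also have "\<dots> \<le> A * C * exp (- real k)"
    proof (intro mult_left_mono)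
      have "A \<ge> 0" using A[of 0] by simp
      then show "A * C \<ge> 0" using C0 by simp
      have "(q - \<bar>q\<bar>) * real k \<le> 0" by (intro mult_nonpos_nonneg) auto
      then show "exp ((q - \<bar>q\<bar>) * real k - real k) \<le> exp (- real k)" by simp
    qed
    finally show ?thesis .
  qed
  have "((\<lambda>p. \<Sum>k. c k * rl_kernel t (x k p)) has_field_derivative
          (\<Sum>k. c k * (n k * rl_kernel_deriv t (x k p\<^sub>0)))) (at p\<^sub>0)"
  proof (rule has_field_derivative_series'(2)[where S = S])
    show "convex S" by (simp add: S_def)
    show "uniformly_convergent_on S (\<lambda>k p. \<Sum>i<k. c i * (n i * rl_kernel_deriv t (x i p)))"
      using bound summable_exp_decay by (rule Weierstrass_m_test')
    show "p\<^sub>0 \<in> S" "p\<^sub>0 \<in> interior S" using \<delta> by (auto simp: S_def)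
    have "superexp_small (\<lambda>k. c k * rl_kernel t (\<alpha> * real k + \<beta>))"
      by (intro superexp_small_mult c superexp_small_rl_kernel t \<alpha> \<beta>)
    then show "summable (\<lambda>k. c k * rl_kernel t (x k p\<^sub>0))"
      using superexp_small_summable summable_rabs_cancel by (auto simp: x_def)
    fix k p assume p: "p \<in> S"
    have "x k p > 0" using x_ge'[OF p, of k] \<beta> by linarith
    moreover have "(x k has_field_derivative n k) (at p within S)"
      unfolding x_def by (auto intro!: derivative_eq_intros)
    ultimately have "((\<lambda>p. rl_kernel t (x k p)) has_field_derivative
                       rl_kernel_deriv t (x k p) * n k) (at p within S)"
      by (intro DERIV_chain'[where g = "rl_kernel t"] rl_kernel_has_derivative t)
    from DERIV_cmult[OF this, of "c k"]
    show "((\<lambda>p. c k * rl_kernel t (x k p)) has_field_derivative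
            c k * (n k * rl_kernel_deriv t (x k p))) (at p within S)"
      by (simp add: mult_ac)
  qed
  then show ?thesis by (simp add: x_def)
qed

section \<open>The Laplace transform of a power\<close>

abbreviation lborel_pos :: "real measure" where
  "lborel_pos \<equiv> restrict_space lborel {0<..}"

lemma laplace_exists_iff:
  "laplace_exists f s \<longleftrightarrow> integrable lborel_pos (\<lambda>t. exp (- s * of_real t) * complex_of_real (f t))"
  unfolding laplace_exists_def set_integrable_def by (subst integrable_restrict_space) auto

lemma laplace_eq:
  "laplace f s = (\<integral>t. exp (- s * of_real t) * complex_of_real (f t) \<partial>lborel_pos)"
  unfolding laplace_def set_lebesgue_integral_def by (subst integral_restrict_space) auto

lemma laplace_cong:
  assumes "\<And>t. t > 0 \<Longrightarrow> f t = g t"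
  shows "laplace f s = laplace g s" "laplace_exists f s \<longleftrightarrow> laplace_exists g s"
  unfolding laplace_eq laplace_exists_iff using assms
  by (auto intro!: Bochner_Integration.integral_cong Bochner_Integration.integrable_cong)

text \<open>
  The substitution \<open>u = \<sigma> * t\<close> in the Gamma integral. It does not extend to complex \<open>\<sigma>\<close>, where it
  would rotate the contour.
\<close>
lemma has_bochner_integral_powr_exp:
  assumes x: "x > 0" and \<sigma>: "\<sigma> > 0"
  shows "has_bochner_integral lborel_pos (\<lambda>t. exp (- \<sigma> * t) * t powr (x - 1)) (Gamma x * \<sigma> powr (- x))"
proof -
  define f :: "real \<Rightarrow> real" where "f t = indicator {0<..} t * (exp (- t) * t powr (x - 1))" for t
  have "(\<integral>\<^sup>+t. ennreal (f t) \<partial>lborel) =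
          (\<integral>\<^sup>+t. ennreal (indicator {0..} t * t powr (x - 1) / exp t) \<partial>lborel)"
    by (intro nn_integral_cong) (auto simp: f_def indicator_def exp_minus divide_inverse mult_ac)
  then have "has_bochner_integral lborel f (Gamma x)"
    using Gamma_conv_nn_integral_real[OF x] Gamma_real_pos[OF x]
    by (intro has_bochner_integral_nn_integral) (auto simp: f_def[abs_def])
  then have "has_bochner_integral lborel (\<lambda>t. f (0 + \<sigma> * t)) (Gamma x /\<^sub>R \<bar>\<sigma>\<bar>)"
    using \<sigma> by (subst (asm) lborel_has_bochner_integral_real_affine_iff[of \<sigma> _ _ 0]) auto
  then have "has_bochner_integral lborel (\<lambda>t. \<sigma> powr (1 - x) * f (0 + \<sigma> * t))
               (\<sigma> powr (1 - x) * (Gamma x /\<^sub>R \<bar>\<sigma>\<bar>))"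
    by (rule has_bochner_integral_mult_right)
  also have "(\<lambda>t. \<sigma> powr (1 - x) * f (0 + \<sigma> * t)) =
               (\<lambda>t. indicator {0<..} t *\<^sub>R (exp (- \<sigma> * t) * t powr (x - 1)))"
  proof
    fix t
    have "\<sigma> powr (1 - x) * (\<sigma> powr (x - 1) * t powr (x - 1)) = t powr (x - 1)"
      using \<sigma> by (simp add: mult.assoc[symmetric] powr_add[symmetric])
    then show "\<sigma> powr (1 - x) * f (0 + \<sigma> * t) =
                 indicator {0<..} t *\<^sub>R (exp (- \<sigma> * t) * t powr (x - 1))"
      using \<sigma> by (auto simp: f_def indicator_def powr_mult zero_less_mult_iff mult_ac)
  qed
  also have "\<sigma> powr (1 - x) * (Gamma x /\<^sub>R \<bar>\<sigma>\<bar>) = Gamma x * \<sigma> powr (- x)"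
    using \<sigma> by (simp add: powr_diff powr_minus field_simps)
  finally show ?thesis
    by (simp add: has_bochner_integral_iff integrable_restrict_space integral_restrict_space)
qed

text \<open>
  For complex \<open>s\<close> in the right half-plane, let \<open>r\<close> be a real centre with \<open>\<bar>r - s\<bar> < r\<close>
  and expand \<open>exp (- s * t) = exp (- r * t) * exp ((r - s) * t)\<close> as a power series in \<open>r - s\<close>.
  Integrating term by term with the real formula at \<open>r\<close> produces the binomial series of
  \<open>(s / r) powr (- x)\<close>, which converges absolutely. The principal branch
  comes out because both \<open>r\<close> and \<open>s / r\<close> lie in the right half-plane.
\<close>
lemma laplace_powr:
  assumes x: "x > 0" and s: "Re s > 0"
  shows "has_bochner_integral lborel_pos
           (\<lambda>t. exp (- s * of_real t) * complex_of_real (t powr (x - 1)))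
           (of_real (Gamma x) * s powr (- of_real x))"
proof -
  \<comment> \<open>This centre gives \<open>\<bar>r - s\<bar>\<^sup>2 = r\<^sup>2 - \<bar>s\<bar>\<^sup>2\<close>.\<close>
  define r where "r = (cmod s)\<^sup>2 / Re s"
  define d where "d = of_real r - s"
  have "s \<noteq> 0" using s by auto
  then have r0: "r > 0" using s by (simp add: r_def)
  have "(cmod d)\<^sup>2 = r\<^sup>2 - (cmod s)\<^sup>2"
  proof -
    have "(cmod d)\<^sup>2 = (r - Re s)\<^sup>2 + (Im s)\<^sup>2" by (simp add: cmod_power2 d_def)
    also have "\<dots> = r\<^sup>2 - 2 * (r * Re s) + (cmod s)\<^sup>2"
      by (simp add: cmod_power2 power2_diff)
    also have "r * Re s = (cmod s)\<^sup>2" using s by (simp add: r_def)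
    finally show ?thesis by simp
  qed
  also have "\<dots> < r\<^sup>2" using s by auto
  finally have d: "cmod d < r" using r0 by (simp add: power_less_imp_less_base)
  define q where "q = cmod d / r"
  have q: "0 \<le> q" "q < 1" using d r0 by (auto simp: q_def)
  define f where "f n t = d ^ n / fact n * of_real (exp (- r * t) * t powr (x + real n - 1))" for n t
  have base: "has_bochner_integral lborel_pos (\<lambda>t. exp (- r * t) * t powr (x + real n - 1))
          (Gamma (x + real n) * r powr (- (x + real n)))" for n
    using has_bochner_integral_powr_exp[of "x + real n" r] x r0 by simp
  have Gn: "Gamma (x + real n) = pochhammer x n * Gamma x" for n
    using pochhammer_Gamma[of x n] pos_not_in_nonpos_Ints[OF x] Gamma_real_pos[OF x] by simp
  have int: "has_bochner_integral lborel_pos (f n)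
        (of_real (Gamma x * r powr (- x)) * ((- of_real x gchoose n) * (- d / of_real r) ^ n))" for n
  proof -
    have "has_bochner_integral lborel_pos (f n)
        (d ^ n / fact n * of_real (Gamma (x + real n) * r powr (- (x + real n))))"
      unfolding f_def by (intro has_bochner_integral_mult_right has_bochner_integral_of_real base)
    moreover have "d ^ n / fact n * of_real (Gamma (x + real n) * r powr (- (x + real n))) =
        of_real (Gamma x * r powr (- x)) * ((- of_real x gchoose n) * (- d / of_real r) ^ n)"
    proof -
      have "r powr (- (x + real n)) = r powr (- x) / r ^ n"
        using r0 by (simp add: powr_diff powr_realpow)
      moreover have "(- d / of_real r) ^ n = (- 1) ^ n * (d ^ n / of_real r ^ n)"
        by (metis mult.left_neutral minus_mult_left power_divide power_mult_distrib times_divide_eq_right)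
      moreover have "(- of_real x gchoose n :: complex) = (- 1) ^ n * of_real (pochhammer x n) / fact n"
        by (simp add: gbinomial_pochhammer pochhammer_of_real)
      moreover have "(- 1) ^ n * (- 1) ^ n = (1 :: complex)"
        by (simp flip: power_mult_distrib)
      then have "(- 1) ^ n * ((- 1) ^ n * z) = (z :: complex)" for z
        by (simp flip: mult.assoc)
      ultimately show ?thesis unfolding Gn by (simp add: mult_ac)
    qed
    ultimately show ?thesis by simp
  qed
  have nint: "(\<integral>t. norm (f n t) \<partial>lborel_pos) = Gamma x * r powr (- x) * (norm (- x gchoose n) * q ^ n)" for n
  proof -
    have "(\<integral>t. norm (f n t) \<partial>lborel_pos) =
            (\<integral>t. cmod d ^ n / fact n * (exp (- r * t) * t powr (x + real n - 1)) \<partial>lborel_pos)"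
      by (intro Bochner_Integration.integral_cong) (auto simp: f_def norm_mult norm_power norm_divide)
    also have "\<dots> = cmod d ^ n / fact n * (Gamma (x + real n) * r powr (- (x + real n)))"
      using base[of n] by (simp add: has_bochner_integral_iff)
    also have "r powr (- (x + real n)) = r powr (- x) / r ^ n"
      using r0 by (simp add: powr_diff powr_realpow)
    also have "cmod d ^ n / fact n * (Gamma (x + real n) * (r powr (- x) / r ^ n)) =
                 Gamma x * r powr (- x) * (pochhammer x n / fact n * q ^ n)"
      unfolding Gn by (simp add: q_def power_divide)
    also have "pochhammer x n / fact n = norm (- x gchoose n)"
      using x by (simp add: gbinomial_pochhammer abs_mult pochhammer_nonneg power_abs)
    finally show ?thesis .
  qed
  have sum_pt: "(\<lambda>n. f n t) sums (exp (- s * of_real t) * of_real (t powr (x - 1)))" if "t > 0" for t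
  proof -
    have "(\<lambda>n. ((d * of_real t) ^ n /\<^sub>R fact n) * of_real (exp (- r * t) * t powr (x - 1))) sums
            (exp (d * of_real t) * of_real (exp (- r * t) * t powr (x - 1)))"
      by (intro sums_mult2 exp_converges)
    also have "exp (d * of_real t) * of_real (exp (- r * t) * t powr (x - 1)) =
                 exp (- s * of_real t) * complex_of_real (t powr (x - 1))"
    proof -
      have "exp (d * of_real t) * of_real (exp (- r * t)) = exp (- s * of_real t)"
        by (simp add: exp_of_real[symmetric] exp_add[symmetric] d_def algebra_simps)
      then show ?thesis by (simp add: mult.assoc[symmetric])
    qed
    also have "(\<lambda>n. ((d * of_real t) ^ n /\<^sub>R fact n) * of_real (exp (- r * t) * t powr (x - 1))) = (\<lambda>n. f n t)"
    proof
      fix n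
      have "t powr (x + real n - 1) = t ^ n * t powr (x - 1)"
        using that by (simp add: powr_realpow[symmetric] powr_add[symmetric] algebra_simps)
      then show "((d * of_real t) ^ n /\<^sub>R fact n) * of_real (exp (- r * t) * t powr (x - 1)) = f n t"
        by (simp add: f_def scaleR_conv_of_real power_mult_distrib field_simps)
    qed
    finally show ?thesis .
  qed
  have eq: "(\<Sum>n. f n t) = exp (- s * of_real t) * complex_of_real (t powr (x - 1))" if "t > 0" for t
    using sum_pt[OF that] by (simp add: sums_iff)
  have i1: "\<And>n. integrable lborel_pos (f n)" using int by (auto simp: has_bochner_integral_iff)
  have i2: "AE t in lborel_pos. summable (\<lambda>n. norm (f n t))"
  proof (rule AE_I2)
    fix t assume "t \<in> space lborel_pos"
    then have t: "t > 0" by simp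
    have "summable (\<lambda>n. norm ((d * of_real t) ^ n /\<^sub>R fact n) * (exp (- r * t) * t powr (x - 1)))"
      by (intro summable_mult2 summable_norm_exp)
    also have "(\<lambda>n. norm ((d * of_real t) ^ n /\<^sub>R fact n) * (exp (- r * t) * t powr (x - 1))) =
               (\<lambda>n. norm (f n t))"
    proof
      fix n
      have "t powr (x + real n - 1) = t ^ n * t powr (x - 1)"
        using t by (simp add: powr_realpow[symmetric] powr_add[symmetric] algebra_simps)
      then show "norm ((d * of_real t) ^ n /\<^sub>R fact n) * (exp (- r * t) * t powr (x - 1)) = norm (f n t)"
        using t by (simp add: f_def norm_mult norm_power norm_divide power_mult_distrib field_simps)
    qed
    finally show "summable (\<lambda>n. norm (f n t))" .
  qed
  have i3: "summable (\<lambda>n. \<integral>t. norm (f n t) \<partial>lborel_pos)"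
  proof -
    have "summable (\<lambda>n. norm ((- x gchoose n) * q ^ n))"
      using q by (intro abs_summable_in_conv_radius) (auto simp: conv_radius_gchoose)
    then show ?thesis
      unfolding nint using q by (intro summable_mult) (simp add: abs_mult)
  qed
  have "(\<lambda>n. of_real (Gamma x * r powr (- x)) * ((- of_real x gchoose n) * (- d / of_real r) ^ n)) sums
          (\<integral>t. (\<Sum>n. f n t) \<partial>lborel_pos)"
    using sums_integral[OF i1 i2 i3] int by (simp add: has_bochner_integral_iff)
  moreover have "(\<lambda>n. of_real (Gamma x * r powr (- x)) * ((- of_real x gchoose n) * (- d / of_real r) ^ n)) sums
          (of_real (Gamma x * r powr (- x)) * (1 + - d / of_real r) powr (- of_real x))"
    using d r0 by (intro sums_mult gen_binomial_complex) (simp add: norm_divide)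
  moreover have "of_real (Gamma x * r powr (- x)) * (1 + - d / of_real r) powr (- of_real x) =
                   of_real (Gamma x) * s powr (- of_real x)"
  proof -
    have "1 + - d / of_real r = s / of_real r"
      using r0 by (simp add: d_def field_simps)
    moreover have "s powr (- of_real x) = of_real (r powr (- x)) * (s / of_real r) powr (- of_real x)"
    proof -
      have "s powr (- of_real x) = (of_real r * (s / of_real r)) powr (- of_real x)"
        using r0 by simp
      also have "\<dots> = of_real r powr (- of_real x) * (s / of_real r) powr (- of_real x)"
        using r0 s by (intro powr_times_real_left) auto
      also have "of_real r powr (- of_real x) = (of_real (r powr (- x)) :: complex)"
        using r0 by (simp add: powr_of_real flip: of_real_minus)
      finally show ?thesis .
    qed
    ultimately show ?thesis by simp
  qed
  ultimately have "(\<integral>t. (\<Sum>n. f n t) \<partial>lborel_pos) = of_real (Gamma x) * s powr (- of_real x)"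
    using sums_unique2 by metis
  then have "has_bochner_integral lborel_pos (\<lambda>t. \<Sum>n. f n t) (of_real (Gamma x) * s powr (- of_real x))"
    using integrable_suminf[OF i1 i2 i3] by (simp add: has_bochner_integral_iff)
  then show ?thesis
    by (rule has_bochner_integral_cong[THEN iffD1, rotated -1]) (auto simp: eq)
qed

section \<open>The Laplace transform of a power times a logarithm\<close>

text \<open>
  The singularity of the logarithm at \<open>0\<close> is paid for with half of the exponent, its growth at
  infinity with one power of \<open>t\<close>. The second summand depends on the lower bound \<open>b\<close> of the order
  only, which keeps the resulting integral bounds uniform when \<open>x\<close> runs through all orders of a
  series.
\<close>
lemma powr_mult_abs_ln_le:
  fixes t b x :: real
  assumes t: "t > 0" and b: "0 < b" "b \<le> x"
  shows "\<bar>ln t\<bar> * t powr (x - 1) \<le> t powr x + 2 / b * t powr (b / 2 - 1)"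
proof (cases "t \<ge> 1")
  case True
  have "\<bar>ln t\<bar> * t powr (x - 1) \<le> t * t powr (x - 1)"
    using True ln_le_self[OF t] by (intro mult_right_mono) auto
  also have "\<dots> = t powr x" using t by (simp add: powr_diff)
  finally show ?thesis using b by (smt (verit) divide_nonneg_nonneg mult_nonneg_nonneg powr_ge_zero)
next
  case False
  have "b / 2 * \<bar>ln t\<bar> = ln (t powr (- (b / 2)))"
    using False t by (simp add: ln_powr)
  also have "\<dots> \<le> t powr (- (b / 2))"
    using t by (intro ln_le_self) simp
  finally have "\<bar>ln t\<bar> \<le> 2 / b * t powr (- (b / 2))"
    using b by (simp add: field_simps)
  moreover have "t powr (x - 1) \<le> t powr (b - 1)"
    using False t b by (intro powr_mono') auto
  ultimately have "\<bar>ln t\<bar> * t powr (x - 1) \<le> (2 / b * t powr (- (b / 2))) * t powr (b - 1)"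
    using b by (intro mult_mono) auto
  also have "\<dots> = 2 / b * t powr (b / 2 - 1)"
    by (simp add: mult.assoc powr_add[symmetric])
  finally show ?thesis by (smt (verit) powr_ge_zero)
qed

lemma borel_measurable_lborel_pos: "f \<in> borel_measurable borel \<Longrightarrow> f \<in> borel_measurable lborel_pos"
  by (rule measurable_restrict_space1) simp

lemma log_powr_exp_integral:
  fixes x b \<sigma> :: real
  assumes "\<sigma> > 0" "0 < b" "b \<le> x"
  shows "integrable lborel_pos (\<lambda>t. exp (- \<sigma> * t) * (\<bar>ln t\<bar> * t powr (x - 1)))"
    and "(\<integral>t. exp (- \<sigma> * t) * (\<bar>ln t\<bar> * t powr (x - 1)) \<partial>lborel_pos)
           \<le> Gamma (x + 1) * \<sigma> powr (- (x + 1)) + 2 / b * (Gamma (b / 2) * \<sigma> powr (- (b / 2)))"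
proof -
  let ?g = "\<lambda>t. exp (- \<sigma> * t) * t powr (x + 1 - 1) + 2 / b * (exp (- \<sigma> * t) * t powr (b / 2 - 1))"
  have g: "has_bochner_integral lborel_pos ?g
      (Gamma (x + 1) * \<sigma> powr (- (x + 1)) + 2 / b * (Gamma (b / 2) * \<sigma> powr (- (b / 2))))"
    using assms
    by (intro has_bochner_integral_add has_bochner_integral_mult_right has_bochner_integral_powr_exp) auto
  have le: "exp (- \<sigma> * t) * (\<bar>ln t\<bar> * t powr (x - 1)) \<le> ?g t" if "t > 0" for t
    using mult_left_mono[OF powr_mult_abs_ln_le[OF that assms(2,3)], of "exp (- \<sigma> * t)"]
    by (simp add: algebra_simps)
  show int: "integrable lborel_pos (\<lambda>t. exp (- \<sigma> * t) * (\<bar>ln t\<bar> * t powr (x - 1)))"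
  proof (rule Bochner_Integration.integrable_bound)
    show "integrable lborel_pos ?g" using g by (simp add: has_bochner_integral_iff)
    show "(\<lambda>t. exp (- \<sigma> * t) * (\<bar>ln t\<bar> * t powr (x - 1))) \<in> borel_measurable lborel_pos"
      by (rule borel_measurable_lborel_pos) measurable
    show "AE t in lborel_pos. norm (exp (- \<sigma> * t) * (\<bar>ln t\<bar> * t powr (x - 1))) \<le> norm (?g t)"
    proof (rule AE_I2)
      fix t assume "t \<in> space lborel_pos"
      then have "t > 0" by simp
      from le[OF this] show "norm (exp (- \<sigma> * t) * (\<bar>ln t\<bar> * t powr (x - 1))) \<le> norm (?g t)"
        unfolding real_norm_def by (subst abs_of_nonneg) (auto intro: order_trans[OF _ abs_ge_self])
    qed
  qed
  show "(\<integral>t. exp (- \<sigma> * t) * (\<bar>ln t\<bar> * t powr (x - 1)) \<partial>lborel_pos)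
           \<le> Gamma (x + 1) * \<sigma> powr (- (x + 1)) + 2 / b * (Gamma (b / 2) * \<sigma> powr (- (b / 2)))"
    unfolding has_bochner_integral_integral_eq[OF g, symmetric]
    using g le by (intro integral_mono int) (auto simp: has_bochner_integral_iff)
qed

lemma DERIV_difference_quotient_LIMSEQ:
  fixes f :: "'a::real_normed_field \<Rightarrow> 'a"
  assumes "(f has_field_derivative D) (at z)"
  shows "(\<lambda>n. (f (z + of_real (inverse (real (Suc n)))) - f z) / of_real (inverse (real (Suc n)))) \<longlonglongrightarrow> D"
proof -
  have "filterlim (\<lambda>n. of_real (inverse (real (Suc n))) :: 'a) (at 0) sequentially"
    unfolding filterlim_at
  proof
    have "(\<lambda>n. of_real (inverse (real (Suc n))) :: 'a) \<longlonglongrightarrow> of_real 0"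
      by (intro tendsto_of_real LIMSEQ_inverse_real_of_nat)
    then show "(\<lambda>n. of_real (inverse (real (Suc n))) :: 'a) \<longlonglongrightarrow> 0" by simp
  qed (auto simp del: of_nat_Suc)
  with assms show ?thesis
    unfolding DERIV_def by (rule filterlim_compose)
qed

text \<open>
  A majorant of the difference quotients of \<open>h \<mapsto> t powr h\<close> at \<open>0\<close> that does not depend on
  \<open>h\<close>, by convexity of the exponential function.
\<close>
lemma powr_difference_quotient_le:
  fixes t h :: real
  assumes "t > 0" "0 < h" "h \<le> 1"
  shows "\<bar>(t powr h - 1) / h\<bar> \<le> \<bar>ln t\<bar> * (1 + t)"
proof -
  define u where "u = h * ln t"
  have e: "t powr h = exp u" using assms by (simp add: u_def powr_def)
  have "\<bar>exp u - 1\<bar> \<le> \<bar>u\<bar> * (1 + t)"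
  proof (cases "u \<ge> 0")
    case True
    have "exp u * (1 + - u) \<le> exp u * exp (- u)"
      by (intro mult_left_mono exp_ge_add_one_self) simp
    then have 1: "exp u - 1 \<le> u * exp u" by (simp add: exp_minus algebra_simps)
    have "ln t \<ge> 0" using True assms by (simp add: u_def zero_le_mult_iff)
    then have "u \<le> ln t" using assms by (simp add: u_def mult_left_le_one_le)
    then have "exp u \<le> t" using assms by (metis exp_le_cancel_iff exp_ln)
    then have "u * exp u \<le> u * (1 + t)" using True assms by (intro mult_left_mono) auto
    then show ?thesis using 1 True by simp
  next
    case False
    have "1 - exp u \<le> - u" using exp_ge_add_one_self[of u] by linarith
    moreover have "- u * 1 \<le> - u * (1 + t)" using False assms by (intro mult_left_mono) auto
    moreover have "exp u \<le> 1" using False by simp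
    ultimately show ?thesis unfolding abs_of_neg[OF False[unfolded not_le]] by linarith
  qed
  then have "\<bar>exp u - 1\<bar> / h \<le> (\<bar>u\<bar> * (1 + t)) / h" using assms by (intro divide_right_mono) auto
  then show ?thesis using assms unfolding e by (simp add: u_def abs_mult)
qed

text \<open>
  This is the derivative with respect to \<open>x\<close> of the transform of \<open>t powr (x - 1)\<close>. The transform is
  known to be \<open>Gamma x * s powr (- x)\<close>, hence differentiable, so dominated convergence along the
  single sequence of steps \<open>1 / (n + 1)\<close> identifies the integral. For steps in \<open>{0<..1}\<close> the
  majorant only has to absorb one extra power of \<open>t\<close>.
\<close>
lemma laplace_powr_ln:
  assumes x: "x > 0" and s: "Re s > 0"
  shows "has_bochner_integral lborel_pos
           (\<lambda>t. exp (- s * of_real t) * complex_of_real (ln t * t powr (x - 1)))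
           (of_real (Gamma x) * s powr (- of_real x) * (of_real (Digamma x) - Ln s))"
proof -
  define h where "h n = inverse (real (Suc n))" for n
  have h: "0 < h n" "h n \<le> 1" for n by (auto simp: h_def divide_simps)
  define F where "F z = Gamma z * s powr (- z)" for z
  define f where "f n t = exp (- s * of_real t) * complex_of_real ((t powr h n - 1) / h n * t powr (x - 1))"
    for n t
  define g where "g t = exp (- s * of_real t) * complex_of_real (ln t * t powr (x - 1))" for t
  define w where "w t = exp (- Re s * t) * (\<bar>ln t\<bar> * t powr (x - 1)) +
                        exp (- Re s * t) * (\<bar>ln t\<bar> * t powr (x + 1 - 1))" for t
  have s0: "s \<noteq> 0" using s by auto
  have wint: "integrable lborel_pos w"
    unfolding w_def using x s
    by (intro Bochner_Integration.integrable_add log_powr_exp_integral(1)[of _ x]) auto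
  have int_f: "has_bochner_integral lborel_pos (f n)
                 ((F (of_real x + of_real (h n)) - F (of_real x)) / of_real (h n))" for n
  proof -
    have "has_bochner_integral lborel_pos
        (\<lambda>t. (exp (- s * of_real t) * complex_of_real (t powr (x + h n - 1)) -
             exp (- s * of_real t) * complex_of_real (t powr (x - 1))) / of_real (h n))
        ((F (of_real (x + h n)) - F (of_real x)) / of_real (h n))"
      unfolding F_def Gamma_complex_of_real using x s h[of n]
      by (intro has_bochner_integral_divide has_bochner_integral_diff laplace_powr) auto
    moreover have "(exp (- s * of_real t) * complex_of_real (t powr (x + h n - 1)) -
             exp (- s * of_real t) * complex_of_real (t powr (x - 1))) / of_real (h n) = f n t" if "t > 0" for t
    proof -
      have "t powr (x + h n - 1) = t powr h n * t powr (x - 1)"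
        by (simp add: powr_add[symmetric] algebra_simps)
      then show ?thesis using h[of n] by (simp add: f_def field_simps)
    qed
    ultimately show ?thesis
      by (subst has_bochner_integral_cong[where g = "\<lambda>t. (exp (- s * of_real t) * complex_of_real (t powr (x + h n - 1)) -
             exp (- s * of_real t) * complex_of_real (t powr (x - 1))) / of_real (h n)"]) auto
  qed
  have m: "f n \<in> borel_measurable lborel_pos" "g \<in> borel_measurable lborel_pos" for n
    unfolding f_def[abs_def] g_def[abs_def] by (rule borel_measurable_lborel_pos; measurable)+
  have lim: "AE t in lborel_pos. (\<lambda>n. f n t) \<longlonglongrightarrow> g t"
  proof (rule AE_I2)
    fix t assume "t \<in> space lborel_pos"
    then have t: "t > 0" by simp
    have "((\<lambda>y. t powr y) has_field_derivative ln t) (at 0)"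
      using t by (auto intro!: derivative_eq_intros simp: powr_def)
    from DERIV_difference_quotient_LIMSEQ[OF this]
    have "(\<lambda>n. (t powr h n - 1) / h n) \<longlonglongrightarrow> ln t"
      using t by (simp add: h_def)
    then show "(\<lambda>n. f n t) \<longlonglongrightarrow> g t"
      unfolding f_def g_def by (intro tendsto_intros)
  qed
  have bound: "AE t in lborel_pos. norm (f n t) \<le> w t" for n
  proof (rule AE_I2)
    fix t assume "t \<in> space lborel_pos"
    then have t: "t > 0" by simp
    have "norm (f n t) = exp (- Re s * t) * (\<bar>(t powr h n - 1) / h n\<bar> * t powr (x - 1))"
      unfolding f_def norm_mult norm_of_real abs_mult by simp
    also have "\<dots> \<le> exp (- Re s * t) * ((\<bar>ln t\<bar> * (1 + t)) * t powr (x - 1))"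
      using powr_difference_quotient_le[OF t h[of n]] by (intro mult_left_mono mult_right_mono) auto
    also have "\<dots> = w t"
      using t by (simp add: w_def powr_diff field_simps)
    finally show "norm (f n t) \<le> w t" .
  qed
  have "(\<lambda>n. \<integral>t. f n t \<partial>lborel_pos) \<longlonglongrightarrow> (\<integral>t. g t \<partial>lborel_pos)"
    by (rule integral_dominated_convergence[OF m(2,1) wint lim bound])
  moreover have "(\<lambda>n. \<integral>t. f n t \<partial>lborel_pos) \<longlonglongrightarrow>
                   of_real (Gamma x) * s powr (- of_real x) * (of_real (Digamma x) - Ln s)"
  proof -
    have nz: "complex_of_real x \<notin> \<int>\<^sub>\<le>\<^sub>0"
      using pos_not_in_nonpos_Ints[OF x] by (simp add: of_real_in_nonpos_Ints_iff)
    have "(F has_field_derivative of_real (Gamma x) * s powr (- of_real x) * (of_real (Digamma x) - Ln s))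
            (at (of_real x))"
      unfolding F_def[abs_def] powr_def using x s0 nz
      by (auto intro!: derivative_eq_intros simp: Gamma_complex_of_real Polygamma_of_real algebra_simps)
    from DERIV_difference_quotient_LIMSEQ[OF this] show ?thesis
      using int_f by (simp add: has_bochner_integral_iff h_def)
  qed
  ultimately have "(\<integral>t. g t \<partial>lborel_pos) =
      of_real (Gamma x) * s powr (- of_real x) * (of_real (Digamma x) - Ln s)"
    using LIMSEQ_unique by blast
  moreover have "integrable lborel_pos g"
    by (rule integrable_dominated_convergence[OF m(2,1) wint lim bound])
  ultimately show ?thesis by (simp add: has_bochner_integral_iff g_def[abs_def])
qed

lemma laplace_rl_kernel:
  assumes "x > 0" "Re s > 0"
  shows "laplace_exists (\<lambda>t. rl_kernel t x) s"
    and "laplace (\<lambda>t. rl_kernel t x) s = s powr (- of_real x)"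
proof -
  have "has_bochner_integral lborel_pos
          (\<lambda>t. exp (- s * of_real t) * complex_of_real (t powr (x - 1)) / of_real (Gamma x))
          (of_real (Gamma x) * s powr (- of_real x) / of_real (Gamma x))"
    by (intro has_bochner_integral_divide laplace_powr assms)
  then show "laplace_exists (\<lambda>t. rl_kernel t x) s"
    and "laplace (\<lambda>t. rl_kernel t x) s = s powr (- of_real x)"
    using Gamma_real_pos[OF assms(1)]
    by (auto simp: laplace_exists_iff laplace_eq has_bochner_integral_iff rl_kernel_def)
qed

text \<open>
  The normalisation by \<open>Gamma x\<close> makes the digamma terms cancel, so only \<open>- Ln s\<close> is left.
\<close>
lemma laplace_rl_kernel_deriv:
  assumes "x > 0" "Re s > 0"
  shows "laplace_exists (\<lambda>t. rl_kernel_deriv t x) s"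
    and "laplace (\<lambda>t. rl_kernel_deriv t x) s = - Ln s * s powr (- of_real x)"
proof -
  let ?f = "\<lambda>t. (exp (- s * of_real t) * complex_of_real (ln t * t powr (x - 1)) -
       of_real (Digamma x) * (exp (- s * of_real t) * complex_of_real (t powr (x - 1)))) / of_real (Gamma x)"
  have "has_bochner_integral lborel_pos ?f
          ((of_real (Gamma x) * s powr (- of_real x) * (of_real (Digamma x) - Ln s) -
            of_real (Digamma x) * (of_real (Gamma x) * s powr (- of_real x))) / of_real (Gamma x))"
    by (intro has_bochner_integral_divide has_bochner_integral_diff has_bochner_integral_mult_right
          laplace_powr laplace_powr_ln assms)
  also have "(of_real (Gamma x) * s powr (- of_real x) * (of_real (Digamma x) - Ln s) -
            of_real (Digamma x) * (of_real (Gamma x) * s powr (- of_real x))) / of_real (Gamma x) =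
            - Ln s * s powr (- of_real x)"
    using Gamma_real_pos[OF assms(1), THEN less_imp_neq, symmetric] by (simp add: field_simps)
  also have "?f = (\<lambda>t. exp (- s * of_real t) * complex_of_real (rl_kernel_deriv t x))"
    by (simp add: fun_eq_iff rl_kernel_deriv_def rl_kernel_def algebra_simps diff_divide_distrib)
  finally show "laplace_exists (\<lambda>t. rl_kernel_deriv t x) s"
    and "laplace (\<lambda>t. rl_kernel_deriv t x) s = - Ln s * s powr (- of_real x)"
    by (auto simp: laplace_exists_iff laplace_eq has_bochner_integral_iff)
qed

section \<open>Termwise Laplace transform of kernel series\<close>

text \<open>
  Along the orders of a Mittag-Leffler series these integrals grow at most exponentially, so the
  superexponentially small coefficients make the series of them converge.
\<close>
lemma exp_bounded_integral_rl_kernel: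
  assumes "\<sigma> > 0" "\<alpha> > 0" "\<beta> > 0"
  shows "exp_bounded (\<lambda>k. \<integral>t. exp (- \<sigma> * t) * \<bar>rl_kernel t (\<alpha> * real k + \<beta>)\<bar> \<partial>lborel_pos)"
proof -
  have "(\<integral>t. exp (- \<sigma> * t) * \<bar>rl_kernel t (\<alpha> * real k + \<beta>)\<bar> \<partial>lborel_pos) = \<sigma> powr (- (\<alpha> * real k + \<beta>))" for k
  proof -
    define x where "x = \<alpha> * real k + \<beta>"
    have x: "x > 0" using assms by (simp add: x_def add_nonneg_pos)
    have "(\<integral>t. exp (- \<sigma> * t) * \<bar>rl_kernel t x\<bar> \<partial>lborel_pos) =
            (\<integral>t. exp (- \<sigma> * t) * t powr (x - 1) / Gamma x \<partial>lborel_pos)"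
      using Gamma_real_pos[OF x] by (simp add: rl_kernel_def)
    also have "\<dots> = \<sigma> powr (- x)"
      using has_bochner_integral_powr_exp[OF x assms(1)] Gamma_real_pos[OF x]
      by (simp add: has_bochner_integral_iff)
    finally show ?thesis by (simp add: x_def)
  qed
  then show ?thesis using exp_bounded_powr[OF assms(1)] by simp
qed

text \<open>
  The three summands of the bound come from the growth of \<open>ln t\<close> at infinity, from its singularity
  at \<open>0\<close> and from the digamma term. The second one is a constant divided by \<open>Gamma (x k)\<close>, since
  its integral depends on the smallest order \<open>\<beta>\<close> only.
\<close>
lemma exp_bounded_integral_rl_kernel_deriv:
  assumes \<sigma>: "\<sigma> > 0" and \<alpha>: "\<alpha> > 0" and \<beta>: "\<beta> > 0"
  shows "exp_bounded (\<lambda>k. \<integral>t. exp (- \<sigma> * t) * \<bar>rl_kernel_deriv t (\<alpha> * real k + \<beta>)\<bar> \<partial>lborel_pos)"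
proof -
  define C where "C = 2 / \<beta> * (Gamma (\<beta> / 2) * \<sigma> powr (- (\<beta> / 2)))"
  define x where "x k = \<alpha> * real k + \<beta>" for k
  let ?B = "\<lambda>k. x k * \<sigma> powr (- (\<alpha> * real k + (\<beta> + 1))) + C * rl_kernel 1 (x k) +
              (\<bar>Digamma \<beta>\<bar> + x k) * \<sigma> powr (- x k)"
  have "exp_bounded ?B"
    unfolding x_def
    by (intro exp_bounded_add exp_bounded_mult exp_bounded_affine exp_bounded_powr exp_bounded_const
          superexp_small_imp_exp_bounded superexp_small_rl_kernel \<sigma> \<alpha> \<beta>) simp_all
  moreover have "\<bar>\<integral>t. exp (- \<sigma> * t) * \<bar>rl_kernel_deriv t (x k)\<bar> \<partial>lborel_pos\<bar> \<le> ?B k" for k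
  proof -
    have xb: "x k \<ge> \<beta>" and x: "x k > 0" using \<alpha> \<beta> by (auto simp: x_def add_nonneg_pos)
    note G = Gamma_real_pos[OF x]
    let ?f = "\<lambda>t. exp (- \<sigma> * t) * (\<bar>ln t\<bar> * t powr (x k - 1))"
    let ?g = "\<lambda>t. exp (- \<sigma> * t) * t powr (x k - 1)"
    note f = log_powr_exp_integral[OF \<sigma> \<beta> xb]
    note g = has_bochner_integral_powr_exp[OF x \<sigma>]
    have meas: "(\<lambda>t. exp (- \<sigma> * t) * \<bar>rl_kernel_deriv t (x k)\<bar>) \<in> borel_measurable lborel_pos"
      unfolding rl_kernel_deriv_def rl_kernel_def by (rule borel_measurable_lborel_pos) measurable
    have int: "integrable lborel_pos (\<lambda>t. (?f t + \<bar>Digamma (x k)\<bar> * ?g t) / Gamma (x k))"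
      using f g by (intro integrable_divide Bochner_Integration.integrable_add integrable_mult_right)
                   (simp_all add: has_bochner_integral_iff)
    have le: "exp (- \<sigma> * t) * \<bar>rl_kernel_deriv t (x k)\<bar> \<le> (?f t + \<bar>Digamma (x k)\<bar> * ?g t) / Gamma (x k)" for t
    proof -
      have "exp (- \<sigma> * t) * \<bar>rl_kernel_deriv t (x k)\<bar> =
              exp (- \<sigma> * t) * (t powr (x k - 1) / Gamma (x k)) * \<bar>ln t - Digamma (x k)\<bar>"
        using G by (simp add: rl_kernel_deriv_def rl_kernel_def abs_mult)
      also have "\<dots> \<le> exp (- \<sigma> * t) * (t powr (x k - 1) / Gamma (x k)) * (\<bar>ln t\<bar> + \<bar>Digamma (x k)\<bar>)"
        using G by (intro mult_left_mono) auto
      also have "\<dots> = (?f t + \<bar>Digamma (x k)\<bar> * ?g t) / Gamma (x k)"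
        by (simp add: algebra_simps add_divide_distrib)
      finally show ?thesis .
    qed
    have "(\<integral>t. exp (- \<sigma> * t) * \<bar>rl_kernel_deriv t (x k)\<bar> \<partial>lborel_pos) \<le>
            (\<integral>t. (?f t + \<bar>Digamma (x k)\<bar> * ?g t) / Gamma (x k) \<partial>lborel_pos)"
      using le by (intro integral_mono' int) (auto intro!: order_trans[OF _ le, simplified])
    also have "\<dots> = ((\<integral>t. ?f t \<partial>lborel_pos) + \<bar>Digamma (x k)\<bar> * (Gamma (x k) * \<sigma> powr (- x k))) / Gamma (x k)"
      using f g by (simp add: has_bochner_integral_iff)
    also have "\<dots> \<le> ((Gamma (x k + 1) * \<sigma> powr (- (x k + 1)) + C) +
                     (\<bar>Digamma \<beta>\<bar> + x k) * (Gamma (x k) * \<sigma> powr (- x k))) / Gamma (x k)"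
      using f(2) G abs_Digamma_le[OF \<beta> xb]
      by (intro divide_right_mono add_mono mult_right_mono) (auto simp: C_def)
    also have "\<dots> = ?B k"
      using G Gamma_plus1[OF pos_not_in_nonpos_Ints[OF x]]
      by (simp add: rl_kernel_def add_divide_distrib) (simp add: x_def algebra_simps)
    finally show ?thesis
      by (subst abs_of_nonneg) (auto intro!: integral_nonneg_AE)
  qed
  ultimately show ?thesis unfolding x_def by (rule exp_bounded_mono)
qed

text \<open>
  Fubini's theorem for a sum and an integral: the integrals of the absolute values of the terms are
  summable because the coefficients decay superexponentially.
\<close>
lemma laplace_series:
  fixes d :: "nat \<Rightarrow> real" and h :: "nat \<Rightarrow> real \<Rightarrow> real"
  assumes ex: "\<And>k. laplace_exists (h k) s"
    and L1: "exp_bounded (\<lambda>k. \<integral>t. exp (- Re s * t) * \<bar>h k t\<bar> \<partial>lborel_pos)"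
    and d: "superexp_small d"
    and pt: "\<And>t. t > 0 \<Longrightarrow> summable (\<lambda>k. \<bar>d k * h k t\<bar>)"
  shows "laplace_exists (\<lambda>t. \<Sum>k. d k * h k t) s"
    and "summable (\<lambda>k. of_real (d k) * laplace (h k) s)"
    and "laplace (\<lambda>t. \<Sum>k. d k * h k t) s = (\<Sum>k. of_real (d k) * laplace (h k) s)"
proof -
  define f where "f k t = of_real (d k) * (exp (- s * of_real t) * complex_of_real (h k t))" for k t
  have n: "norm (f k t) = \<bar>d k\<bar> * (exp (- Re s * t) * \<bar>h k t\<bar>)" for k t
    by (simp add: f_def norm_mult)
  have i1: "integrable lborel_pos (f k)" for k
    unfolding f_def using ex[of k] by (intro integrable_mult_right) (simp add: laplace_exists_iff)
  have i2: "AE t in lborel_pos. summable (\<lambda>k. norm (f k t))"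
  proof (rule AE_I2)
    fix t assume "t \<in> space lborel_pos"
    then have "summable (\<lambda>k. \<bar>d k * h k t\<bar> * exp (- Re s * t))"
      by (intro summable_mult2 pt) simp
    then show "summable (\<lambda>k. norm (f k t))"
      unfolding n by (simp add: abs_mult mult_ac)
  qed
  have i3: "summable (\<lambda>k. \<integral>t. norm (f k t) \<partial>lborel_pos)"
  proof -
    have "(\<integral>t. norm (f k t) \<partial>lborel_pos) =
            \<bar>(\<integral>t. exp (- Re s * t) * \<bar>h k t\<bar> \<partial>lborel_pos) * d k\<bar>" for k
      unfolding n abs_mult
      by (subst (2) abs_of_nonneg) (auto intro!: integral_nonneg_AE simp: mult.commute)
    then show ?thesis
      using superexp_small_summable[OF superexp_small_mult[OF L1 d]] by simp
  qed
  have sum: "(\<Sum>k. f k t) = exp (- s * of_real t) * complex_of_real (\<Sum>k. d k * h k t)" if "t > 0" for t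
  proof -
    have "summable (\<lambda>k. d k * h k t)"
      using pt[OF that] by (rule summable_rabs_cancel)
    then have "(\<lambda>k. exp (- s * of_real t) * complex_of_real (d k * h k t)) sums
            (exp (- s * of_real t) * complex_of_real (\<Sum>k. d k * h k t))"
      by (intro sums_mult sums_of_real summable_sums)
    then show ?thesis by (simp add: f_def sums_iff mult_ac)
  qed
  have "integrable lborel_pos (\<lambda>t. \<Sum>k. f k t)"
    by (rule integrable_suminf[OF i1 i2 i3])
  then show "laplace_exists (\<lambda>t. \<Sum>k. d k * h k t) s"
    unfolding laplace_exists_iff
    by (rule Bochner_Integration.integrable_cong[THEN iffD1, rotated -1]) (auto simp: sum)
  have "(\<lambda>k. \<integral>t. f k t \<partial>lborel_pos) sums (\<integral>t. (\<Sum>k. f k t) \<partial>lborel_pos)"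
    by (rule sums_integral[OF i1 i2 i3])
  also have "(\<integral>t. (\<Sum>k. f k t) \<partial>lborel_pos) = laplace (\<lambda>t. \<Sum>k. d k * h k t) s"
    unfolding laplace_eq by (rule Bochner_Integration.integral_cong) (auto simp: sum)
  also have "(\<lambda>k. \<integral>t. f k t \<partial>lborel_pos) = (\<lambda>k. of_real (d k) * laplace (h k) s)"
    by (simp add: f_def laplace_eq)
  finally show "summable (\<lambda>k. of_real (d k) * laplace (h k) s)"
    and "laplace (\<lambda>t. \<Sum>k. d k * h k t) s = (\<Sum>k. of_real (d k) * laplace (h k) s)"
    by (auto simp: sums_iff)
qed

text \<open>
  All four transforms are instances of this lemma: derivatives with respect to the parameters of the
  first Gamma factor act on the kernel and give the factor \<open>- Ln s\<close>, while derivatives with respect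
  to the parameters of the second one only change the coefficients \<open>d\<close>.
\<close>
lemma laplace_rl_kernel_series:
  assumes "\<alpha> > 0" "\<beta> > 0" "Re s > 0" and d: "superexp_small d"
  defines "w \<equiv> s powr (- of_real \<alpha>)"
  shows "laplace_exists (\<lambda>t. \<Sum>k. d k * rl_kernel t (\<alpha> * real k + \<beta>)) s"
    and "summable (\<lambda>k. of_real (d k) * w ^ k)"
    and "laplace (\<lambda>t. \<Sum>k. d k * rl_kernel t (\<alpha> * real k + \<beta>)) s =
           1 / s powr of_real \<beta> * (\<Sum>k. of_real (d k) * w ^ k)"
    and "laplace_exists (\<lambda>t. \<Sum>k. d k * rl_kernel_deriv t (\<alpha> * real k + \<beta>)) s"
    and "laplace (\<lambda>t. \<Sum>k. d k * rl_kernel_deriv t (\<alpha> * real k + \<beta>)) s =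
           - (Ln s / s powr of_real \<beta>) * (\<Sum>k. of_real (d k) * w ^ k)"
proof -
  have s0: "s \<noteq> 0" using assms by auto
  have x: "\<alpha> * real k + \<beta> > 0" for k using assms by (simp add: add_nonneg_pos)
  have pw: "s powr (- of_real (\<alpha> * real k + \<beta>)) = 1 / s powr of_real \<beta> * w ^ k" for k
    using s0 by (simp add: w_def powr_def exp_of_nat_mult[symmetric] exp_minus[symmetric]
        exp_add[symmetric] divide_inverse algebra_simps)
  have pt: "summable (\<lambda>k. \<bar>d k * rl_kernel t (\<alpha> * real k + \<beta>)\<bar>)"
    "summable (\<lambda>k. \<bar>d k * rl_kernel_deriv t (\<alpha> * real k + \<beta>)\<bar>)" if "t > 0" for t
    using that assms
    by (intro superexp_small_summable superexp_small_mult superexp_small_imp_exp_bounded[OF d]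
        superexp_small_rl_kernel; simp)+
  note L = laplace_series[where h = "\<lambda>k t. rl_kernel t (\<alpha> * real k + \<beta>)",
      OF laplace_rl_kernel(1)[OF x assms(3)] exp_bounded_integral_rl_kernel[OF assms(3,1,2)] d pt(1)]
  note L' = laplace_series[where h = "\<lambda>k t. rl_kernel_deriv t (\<alpha> * real k + \<beta>)",
      OF laplace_rl_kernel_deriv(1)[OF x assms(3)] exp_bounded_integral_rl_kernel_deriv[OF assms(3,1,2)] d pt(2)]
  show "laplace_exists (\<lambda>t. \<Sum>k. d k * rl_kernel t (\<alpha> * real k + \<beta>)) s"
    "laplace_exists (\<lambda>t. \<Sum>k. d k * rl_kernel_deriv t (\<alpha> * real k + \<beta>)) s"
    by (rule L(1) L'(1); assumption)+
  have "summable (\<lambda>k. of_real (d k) * laplace (\<lambda>t. rl_kernel t (\<alpha> * real k + \<beta>)) s)"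
    by (rule L(2))
  then have "summable (\<lambda>k. s powr of_real \<beta> * (of_real (d k) * (1 / s powr of_real \<beta> * w ^ k)))"
    unfolding laplace_rl_kernel(2)[OF x assms(3)] pw by (rule summable_mult)
  then show sm: "summable (\<lambda>k. of_real (d k) * w ^ k)"
    using s0 by simp
  have "laplace (\<lambda>t. \<Sum>k. d k * rl_kernel t (\<alpha> * real k + \<beta>)) s =
          (\<Sum>k. of_real (d k) * laplace (\<lambda>t. rl_kernel t (\<alpha> * real k + \<beta>)) s)"
    by (rule L(3))
  also have "\<dots> = (\<Sum>k. 1 / s powr of_real \<beta> * (of_real (d k) * w ^ k))"
    unfolding laplace_rl_kernel(2)[OF x assms(3)] pw by (simp add: mult_ac)
  finally show "laplace (\<lambda>t. \<Sum>k. d k * rl_kernel t (\<alpha> * real k + \<beta>)) s =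
           1 / s powr of_real \<beta> * (\<Sum>k. of_real (d k) * w ^ k)"
    by (simp only: suminf_mult[OF sm])
  have "laplace (\<lambda>t. \<Sum>k. d k * rl_kernel_deriv t (\<alpha> * real k + \<beta>)) s =
          (\<Sum>k. of_real (d k) * laplace (\<lambda>t. rl_kernel_deriv t (\<alpha> * real k + \<beta>)) s)"
    by (rule L'(3))
  also have "\<dots> = (\<Sum>k. - (Ln s / s powr of_real \<beta>) * (of_real (d k) * w ^ k))"
    unfolding laplace_rl_kernel_deriv(2)[OF x assms(3)] pw by (simp add: mult_ac)
  finally show "laplace (\<lambda>t. \<Sum>k. d k * rl_kernel_deriv t (\<alpha> * real k + \<beta>)) s =
           - (Ln s / s powr of_real \<beta>) * (\<Sum>k. of_real (d k) * w ^ k)"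
    by (simp only: suminf_mult[OF sm])
qed

lemma rl_kernel_1: "rl_kernel 1 y = 1 / Gamma y" "rl_kernel_deriv 1 y = - (Digamma y / Gamma y)"
  by (simp_all add: rl_kernel_def rl_kernel_deriv_def)

section \<open>Parameter derivatives of the four-parametric Mittag-Leffler function\<close>

lemma ml_fun_eq_series:
  assumes "t > 0" "\<alpha>\<^sub>1 > 0" "\<alpha>\<^sub>2 > 0" "\<beta>\<^sub>1 > 0" "\<beta>\<^sub>2 > 0"
  shows "ml_fun l \<alpha>\<^sub>1 \<beta>\<^sub>1 \<alpha>\<^sub>2 \<beta>\<^sub>2 t =
           (\<Sum>k. l ^ k * rl_kernel 1 (\<alpha>\<^sub>2 * real k + \<beta>\<^sub>2) * rl_kernel t (\<alpha>\<^sub>1 * real k + \<beta>\<^sub>1))"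
proof -
  let ?a = "\<lambda>k. (l * t powr \<alpha>\<^sub>1) ^ k / (Gamma (\<alpha>\<^sub>1 * real k + \<beta>\<^sub>1) * Gamma (\<alpha>\<^sub>2 * real k + \<beta>\<^sub>2))"
  have "superexp_small (\<lambda>k. ((l * t powr \<alpha>\<^sub>1) ^ k * rl_kernel 1 (\<alpha>\<^sub>1 * real k + \<beta>\<^sub>1)) *
          rl_kernel 1 (\<alpha>\<^sub>2 * real k + \<beta>\<^sub>2))"
    using assms by (intro superexp_small_mult exp_bounded_mult exp_bounded_power
        superexp_small_imp_exp_bounded superexp_small_rl_kernel) simp_all
  from summable_rabs_cancel[OF superexp_small_summable[OF this]]
  have "summable ?a" by (simp add: rl_kernel_1)
  from suminf_mult[OF this, of "t powr (\<beta>\<^sub>1 - 1)", symmetric]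
  have "ml_fun l \<alpha>\<^sub>1 \<beta>\<^sub>1 \<alpha>\<^sub>2 \<beta>\<^sub>2 t = (\<Sum>k. t powr (\<beta>\<^sub>1 - 1) * ?a k)"
    by (simp add: ml_fun_def mittag_leffler4_def)
  also have "\<dots> = (\<Sum>k. l ^ k * rl_kernel 1 (\<alpha>\<^sub>2 * real k + \<beta>\<^sub>2) * rl_kernel t (\<alpha>\<^sub>1 * real k + \<beta>\<^sub>1))"
  proof (rule suminf_cong)
    fix k
    have "t powr (\<alpha>\<^sub>1 * real k + \<beta>\<^sub>1 - 1) = (t powr \<alpha>\<^sub>1) ^ k * t powr (\<beta>\<^sub>1 - 1)"
      using assms(1) by (simp add: powr_realpow[symmetric] powr_powr powr_add[symmetric] algebra_simps)
    then show "t powr (\<beta>\<^sub>1 - 1) * ?a k =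
        l ^ k * rl_kernel 1 (\<alpha>\<^sub>2 * real k + \<beta>\<^sub>2) * rl_kernel t (\<alpha>\<^sub>1 * real k + \<beta>\<^sub>1)"
      by (simp add: rl_kernel_def power_mult_distrib mult_ac)
  qed
  finally show ?thesis .
qed

lemma ml_fun_has_derivative:
  assumes t: "t > 0" and p: "\<alpha>\<^sub>1 > 0" "\<alpha>\<^sub>2 > 0" "\<beta>\<^sub>1 > 0" "\<beta>\<^sub>2 > 0"
  shows "((\<lambda>a. ml_fun l a \<beta>\<^sub>1 \<alpha>\<^sub>2 \<beta>\<^sub>2 t) has_field_derivative
           (\<Sum>k. l ^ k * real k * rl_kernel 1 (\<alpha>\<^sub>2 * real k + \<beta>\<^sub>2) *
             rl_kernel_deriv t (\<alpha>\<^sub>1 * real k + \<beta>\<^sub>1))) (at \<alpha>\<^sub>1)" (is "(_ has_field_derivative ?DA1) _")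
    and "((\<lambda>b. ml_fun l \<alpha>\<^sub>1 b \<alpha>\<^sub>2 \<beta>\<^sub>2 t) has_field_derivative
           (\<Sum>k. l ^ k * rl_kernel 1 (\<alpha>\<^sub>2 * real k + \<beta>\<^sub>2) *
             rl_kernel_deriv t (\<alpha>\<^sub>1 * real k + \<beta>\<^sub>1))) (at \<beta>\<^sub>1)" (is "(_ has_field_derivative ?DB1) _")
    and "((\<lambda>a. ml_fun l \<alpha>\<^sub>1 \<beta>\<^sub>1 a \<beta>\<^sub>2 t) has_field_derivative
           (\<Sum>k. l ^ k * real k * rl_kernel_deriv 1 (\<alpha>\<^sub>2 * real k + \<beta>\<^sub>2) *
             rl_kernel t (\<alpha>\<^sub>1 * real k + \<beta>\<^sub>1))) (at \<alpha>\<^sub>2)" (is "(_ has_field_derivative ?DA2) _")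
    and "((\<lambda>b. ml_fun l \<alpha>\<^sub>1 \<beta>\<^sub>1 \<alpha>\<^sub>2 b t) has_field_derivative
           (\<Sum>k. l ^ k * rl_kernel_deriv 1 (\<alpha>\<^sub>2 * real k + \<beta>\<^sub>2) *
             rl_kernel t (\<alpha>\<^sub>1 * real k + \<beta>\<^sub>1))) (at \<beta>\<^sub>2)" (is "(_ has_field_derivative ?DB2) _")
proof -
  have c1: "exp_bounded (\<lambda>k. l ^ k * rl_kernel 1 (\<alpha>\<^sub>2 * real k + \<beta>\<^sub>2))"
    using p by (intro exp_bounded_mult exp_bounded_power superexp_small_imp_exp_bounded
        superexp_small_rl_kernel) simp_all
  have c2: "exp_bounded (\<lambda>k. l ^ k * rl_kernel t (\<alpha>\<^sub>1 * real k + \<beta>\<^sub>1))"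
    using t p by (intro exp_bounded_mult exp_bounded_power superexp_small_imp_exp_bounded
        superexp_small_rl_kernel) simp_all
  note D1 = rl_kernel_series_has_derivative[OF t p(1,3) c1]
  note D2 = rl_kernel_series_has_derivative[OF zero_less_one p(2,4) c2]
  have eq: "ml_fun l p \<beta>\<^sub>1 \<alpha>\<^sub>2 \<beta>\<^sub>2 t = (\<Sum>k. l ^ k * rl_kernel 1 (\<alpha>\<^sub>2 * real k + \<beta>\<^sub>2) *
      rl_kernel t (\<alpha>\<^sub>1 * real k + \<beta>\<^sub>1 + real k * (p - \<alpha>\<^sub>1)))" if "p > 0" for p
    unfolding ml_fun_eq_series[OF t that p(2,3,4)] by (simp add: algebra_simps)
  have "((\<lambda>p. \<Sum>k. l ^ k * rl_kernel 1 (\<alpha>\<^sub>2 * real k + \<beta>\<^sub>2) *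
      rl_kernel t (\<alpha>\<^sub>1 * real k + \<beta>\<^sub>1 + real k * (p - \<alpha>\<^sub>1))) has_field_derivative ?DA1) (at \<alpha>\<^sub>1)"
    using D1[where n = real and p\<^sub>0 = \<alpha>\<^sub>1] by (simp add: mult_ac)
  then show "((\<lambda>a. ml_fun l a \<beta>\<^sub>1 \<alpha>\<^sub>2 \<beta>\<^sub>2 t) has_field_derivative ?DA1) (at \<alpha>\<^sub>1)"
    by (rule has_field_derivative_transform_within_open[where S = "{0<..}"]) (use p in \<open>auto simp: eq\<close>)
  have eq: "ml_fun l \<alpha>\<^sub>1 p \<alpha>\<^sub>2 \<beta>\<^sub>2 t = (\<Sum>k. l ^ k * rl_kernel 1 (\<alpha>\<^sub>2 * real k + \<beta>\<^sub>2) *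
      rl_kernel t (\<alpha>\<^sub>1 * real k + \<beta>\<^sub>1 + 1 * (p - \<beta>\<^sub>1)))" if "p > 0" for p
    unfolding ml_fun_eq_series[OF t p(1,2) that p(4)] by (simp add: algebra_simps)
  have "((\<lambda>p. \<Sum>k. l ^ k * rl_kernel 1 (\<alpha>\<^sub>2 * real k + \<beta>\<^sub>2) *
      rl_kernel t (\<alpha>\<^sub>1 * real k + \<beta>\<^sub>1 + 1 * (p - \<beta>\<^sub>1))) has_field_derivative ?DB1) (at \<beta>\<^sub>1)"
    using D1[where n = "\<lambda>_. 1" and p\<^sub>0 = \<beta>\<^sub>1] by (simp add: mult_ac)
  then show "((\<lambda>b. ml_fun l \<alpha>\<^sub>1 b \<alpha>\<^sub>2 \<beta>\<^sub>2 t) has_field_derivative ?DB1) (at \<beta>\<^sub>1)"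
    by (rule has_field_derivative_transform_within_open[where S = "{0<..}"]) (use p in \<open>auto simp: eq\<close>)
  have eq: "ml_fun l \<alpha>\<^sub>1 \<beta>\<^sub>1 p \<beta>\<^sub>2 t = (\<Sum>k. l ^ k * rl_kernel t (\<alpha>\<^sub>1 * real k + \<beta>\<^sub>1) *
      rl_kernel 1 (\<alpha>\<^sub>2 * real k + \<beta>\<^sub>2 + real k * (p - \<alpha>\<^sub>2)))" if "p > 0" for p
    unfolding ml_fun_eq_series[OF t p(1) that p(3,4)] by (simp add: algebra_simps)
  have "((\<lambda>p. \<Sum>k. l ^ k * rl_kernel t (\<alpha>\<^sub>1 * real k + \<beta>\<^sub>1) *
      rl_kernel 1 (\<alpha>\<^sub>2 * real k + \<beta>\<^sub>2 + real k * (p - \<alpha>\<^sub>2))) has_field_derivative ?DA2) (at \<alpha>\<^sub>2)"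
    using D2[where n = real and p\<^sub>0 = \<alpha>\<^sub>2] by (simp add: mult_ac)
  then show "((\<lambda>a. ml_fun l \<alpha>\<^sub>1 \<beta>\<^sub>1 a \<beta>\<^sub>2 t) has_field_derivative ?DA2) (at \<alpha>\<^sub>2)"
    by (rule has_field_derivative_transform_within_open[where S = "{0<..}"]) (use p in \<open>auto simp: eq\<close>)
  have eq: "ml_fun l \<alpha>\<^sub>1 \<beta>\<^sub>1 \<alpha>\<^sub>2 p t = (\<Sum>k. l ^ k * rl_kernel t (\<alpha>\<^sub>1 * real k + \<beta>\<^sub>1) *
      rl_kernel 1 (\<alpha>\<^sub>2 * real k + \<beta>\<^sub>2 + 1 * (p - \<beta>\<^sub>2)))" if "p > 0" for p
    unfolding ml_fun_eq_series[OF t p(1-3) that] by (simp add: algebra_simps)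
  have "((\<lambda>p. \<Sum>k. l ^ k * rl_kernel t (\<alpha>\<^sub>1 * real k + \<beta>\<^sub>1) *
      rl_kernel 1 (\<alpha>\<^sub>2 * real k + \<beta>\<^sub>2 + 1 * (p - \<beta>\<^sub>2))) has_field_derivative ?DB2) (at \<beta>\<^sub>2)"
    using D2[where n = "\<lambda>_. 1" and p\<^sub>0 = \<beta>\<^sub>2] by (simp add: mult_ac)
  then show "((\<lambda>b. ml_fun l \<alpha>\<^sub>1 \<beta>\<^sub>1 \<alpha>\<^sub>2 b t) has_field_derivative ?DB2) (at \<beta>\<^sub>2)"
    by (rule has_field_derivative_transform_within_open[where S = "{0<..}"]) (use p in \<open>auto simp: eq\<close>)
qed

theorem theorem9:
  fixes \<alpha>\<^sub>1 \<alpha>\<^sub>2 \<beta>\<^sub>1 \<beta>\<^sub>2 l :: real and s :: complex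
  assumes "\<alpha>\<^sub>1 > 0" and "\<alpha>\<^sub>2 > 0" and "\<beta>\<^sub>1 > 0" and "\<beta>\<^sub>2 > 0" and "Re s > 0"
  defines "D\<alpha>\<^sub>1 \<equiv> \<lambda>t. deriv (\<lambda>a. ml_fun l a \<beta>\<^sub>1 \<alpha>\<^sub>2 \<beta>\<^sub>2 t) \<alpha>\<^sub>1"
    and "D\<beta>\<^sub>1 \<equiv> \<lambda>t. deriv (\<lambda>b. ml_fun l \<alpha>\<^sub>1 b \<alpha>\<^sub>2 \<beta>\<^sub>2 t) \<beta>\<^sub>1"
    and "D\<alpha>\<^sub>2 \<equiv> \<lambda>t. deriv (\<lambda>a. ml_fun l \<alpha>\<^sub>1 \<beta>\<^sub>1 a \<beta>\<^sub>2 t) \<alpha>\<^sub>2"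
    and "D\<beta>\<^sub>2 \<equiv> \<lambda>t. deriv (\<lambda>b. ml_fun l \<alpha>\<^sub>1 \<beta>\<^sub>1 \<alpha>\<^sub>2 b t) \<beta>\<^sub>2"
    and "w \<equiv> complex_of_real l * s powr (- complex_of_real \<alpha>\<^sub>1)"
  shows
    "(\<forall>t>0. (\<lambda>a. ml_fun l a \<beta>\<^sub>1 \<alpha>\<^sub>2 \<beta>\<^sub>2 t) field_differentiable at \<alpha>\<^sub>1) \<and>
     laplace_exists D\<alpha>\<^sub>1 s \<and>
     summable (\<lambda>k. of_nat k * w ^ k / complex_of_real (Gamma (\<alpha>\<^sub>2 * real k + \<beta>\<^sub>2))) \<and>
     laplace D\<alpha>\<^sub>1 s = - (Ln s / s powr complex_of_real \<beta>\<^sub>1) *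
       (\<Sum>k. of_nat k * w ^ k / complex_of_real (Gamma (\<alpha>\<^sub>2 * real k + \<beta>\<^sub>2))) \<and>

     (\<forall>t>0. (\<lambda>b. ml_fun l \<alpha>\<^sub>1 b \<alpha>\<^sub>2 \<beta>\<^sub>2 t) field_differentiable at \<beta>\<^sub>1) \<and>
     laplace_exists D\<beta>\<^sub>1 s \<and>
     laplace D\<beta>\<^sub>1 s = - (Ln s / s powr complex_of_real \<beta>\<^sub>1) * mittag_leffler \<alpha>\<^sub>2 \<beta>\<^sub>2 w \<and>

     (\<forall>t>0. (\<lambda>a. ml_fun l \<alpha>\<^sub>1 \<beta>\<^sub>1 a \<beta>\<^sub>2 t) field_differentiable at \<alpha>\<^sub>2) \<and>
     laplace_exists D\<alpha>\<^sub>2 s \<and>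
     summable (\<lambda>k. complex_of_real (real k * Digamma (\<alpha>\<^sub>2 * real k + \<beta>\<^sub>2)
                      / Gamma (\<alpha>\<^sub>2 * real k + \<beta>\<^sub>2)) * w ^ k) \<and>
     laplace D\<alpha>\<^sub>2 s = - (1 / s powr complex_of_real \<beta>\<^sub>1) *
       (\<Sum>k. complex_of_real (real k * Digamma (\<alpha>\<^sub>2 * real k + \<beta>\<^sub>2)
                      / Gamma (\<alpha>\<^sub>2 * real k + \<beta>\<^sub>2)) * w ^ k) \<and>

     (\<forall>t>0. (\<lambda>b. ml_fun l \<alpha>\<^sub>1 \<beta>\<^sub>1 \<alpha>\<^sub>2 b t) field_differentiable at \<beta>\<^sub>2) \<and>
     laplace_exists D\<beta>\<^sub>2 s \<and>
     summable (\<lambda>k. complex_of_real (Digamma (\<alpha>\<^sub>2 * real k + \<beta>\<^sub>2)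
                      / Gamma (\<alpha>\<^sub>2 * real k + \<beta>\<^sub>2)) * w ^ k) \<and>
     laplace D\<beta>\<^sub>2 s = - (1 / s powr complex_of_real \<beta>\<^sub>1) *
       (\<Sum>k. complex_of_real (Digamma (\<alpha>\<^sub>2 * real k + \<beta>\<^sub>2)
                      / Gamma (\<alpha>\<^sub>2 * real k + \<beta>\<^sub>2)) * w ^ k)"
proof -
  let ?x = "\<lambda>k. \<alpha>\<^sub>1 * real k + \<beta>\<^sub>1" and ?y = "\<lambda>k. \<alpha>\<^sub>2 * real k + \<beta>\<^sub>2"
  note params = assms(1-4) and s = assms(5)
  note D = ml_fun_has_derivative[where l = l, OF _ assms(1,2,3,4)]
  have small: "superexp_small (\<lambda>k. l ^ k * rl_kernel 1 (?y k))"
    "superexp_small (\<lambda>k. l ^ k * rl_kernel_deriv 1 (?y k))"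
    "superexp_small (\<lambda>k. l ^ k * real k * rl_kernel 1 (?y k))"
    "superexp_small (\<lambda>k. l ^ k * real k * rl_kernel_deriv 1 (?y k))"
    using params
    by (intro superexp_small_mult exp_bounded_mult exp_bounded_power exp_bounded_of_nat
        superexp_small_rl_kernel; simp)+
  note L = laplace_rl_kernel_series[OF assms(1,3) s]
  have w: "of_real l ^ k * (s powr (- of_real \<alpha>\<^sub>1)) ^ k = w ^ k" for k
    by (simp add: w_def power_mult_distrib)
  have diff: "\<forall>t>0. (\<lambda>a. ml_fun l a \<beta>\<^sub>1 \<alpha>\<^sub>2 \<beta>\<^sub>2 t) field_differentiable at \<alpha>\<^sub>1"
    "\<forall>t>0. (\<lambda>b. ml_fun l \<alpha>\<^sub>1 b \<alpha>\<^sub>2 \<beta>\<^sub>2 t) field_differentiable at \<beta>\<^sub>1"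
    "\<forall>t>0. (\<lambda>a. ml_fun l \<alpha>\<^sub>1 \<beta>\<^sub>1 a \<beta>\<^sub>2 t) field_differentiable at \<alpha>\<^sub>2"
    "\<forall>t>0. (\<lambda>b. ml_fun l \<alpha>\<^sub>1 \<beta>\<^sub>1 \<alpha>\<^sub>2 b t) field_differentiable at \<beta>\<^sub>2"
    using D unfolding field_differentiable_def by blast+
  have D\<alpha>\<^sub>1: "D\<alpha>\<^sub>1 t = (\<Sum>k. l ^ k * real k * rl_kernel 1 (?y k) * rl_kernel_deriv t (?x k))"
    and D\<beta>\<^sub>1: "D\<beta>\<^sub>1 t = (\<Sum>k. l ^ k * rl_kernel 1 (?y k) * rl_kernel_deriv t (?x k))"
    and D\<alpha>\<^sub>2: "D\<alpha>\<^sub>2 t = (\<Sum>k. l ^ k * real k * rl_kernel_deriv 1 (?y k) * rl_kernel t (?x k))"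
    and D\<beta>\<^sub>2: "D\<beta>\<^sub>2 t = (\<Sum>k. l ^ k * rl_kernel_deriv 1 (?y k) * rl_kernel t (?x k))" if "t > 0" for t
    unfolding D\<alpha>\<^sub>1_def D\<beta>\<^sub>1_def D\<alpha>\<^sub>2_def D\<beta>\<^sub>2_def by (intro DERIV_imp_deriv D that)+
  have c1: "complex_of_real (l ^ k * real k * rl_kernel 1 (?y k)) * (s powr (- of_real \<alpha>\<^sub>1)) ^ k =
      of_nat k * w ^ k / complex_of_real (Gamma (?y k))" for k
    unfolding w[symmetric] by (simp add: rl_kernel_1 mult_ac)
  have c2: "complex_of_real (l ^ k * rl_kernel 1 (?y k)) * (s powr (- of_real \<alpha>\<^sub>1)) ^ k =
      w ^ k / complex_of_real (Gamma (?y k))" for k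
    unfolding w[symmetric] by (simp add: rl_kernel_1 mult_ac)
  have c3: "complex_of_real (l ^ k * real k * rl_kernel_deriv 1 (?y k)) * (s powr (- of_real \<alpha>\<^sub>1)) ^ k =
      - (complex_of_real (real k * Digamma (?y k) / Gamma (?y k)) * w ^ k)" for k
    unfolding w[symmetric] by (simp add: rl_kernel_1 mult_ac)
  have c4: "complex_of_real (l ^ k * rl_kernel_deriv 1 (?y k)) * (s powr (- of_real \<alpha>\<^sub>1)) ^ k =
      - (complex_of_real (Digamma (?y k) / Gamma (?y k)) * w ^ k)" for k
    unfolding w[symmetric] by (simp add: rl_kernel_1 mult_ac)
  note M1 = L[OF small(3), unfolded c1] and M2 = L[OF small(1), unfolded c2]
    and M3 = L[OF small(4), unfolded c3 summable_minus_iff] and M4 = L[OF small(2), unfolded c4 summable_minus_iff]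
  have R1: "laplace_exists D\<alpha>\<^sub>1 s" "laplace D\<alpha>\<^sub>1 s = - (Ln s / s powr of_real \<beta>\<^sub>1) * (\<Sum>k. of_nat k * w ^ k / of_real (Gamma (?y k)))"
    using M1(4,5) laplace_cong[where f = D\<alpha>\<^sub>1, OF D\<alpha>\<^sub>1] by simp_all
  have R2: "laplace_exists D\<beta>\<^sub>1 s" "laplace D\<beta>\<^sub>1 s = - (Ln s / s powr of_real \<beta>\<^sub>1) * mittag_leffler \<alpha>\<^sub>2 \<beta>\<^sub>2 w"
    using M2(4,5) laplace_cong[where f = D\<beta>\<^sub>1, OF D\<beta>\<^sub>1] by (simp_all add: mittag_leffler_def)
  have R3: "laplace_exists D\<alpha>\<^sub>2 s" "laplace D\<alpha>\<^sub>2 s = - (1 / s powr of_real \<beta>\<^sub>1) * (\<Sum>k. of_real (real k * Digamma (?y k) / Gamma (?y k)) * w ^ k)"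
    using M3(1) M3(3)[unfolded suminf_minus[OF M3(2)]] laplace_cong[where f = D\<alpha>\<^sub>2, OF D\<alpha>\<^sub>2] by simp_all
  have R4: "laplace_exists D\<beta>\<^sub>2 s" "laplace D\<beta>\<^sub>2 s = - (1 / s powr of_real \<beta>\<^sub>1) * (\<Sum>k. of_real (Digamma (?y k) / Gamma (?y k)) * w ^ k)"
    using M4(1) M4(3)[unfolded suminf_minus[OF M4(2)]] laplace_cong[where f = D\<beta>\<^sub>2, OF D\<beta>\<^sub>2] by simp_all
  show ?thesis
    using diff R1 R2 R3 R4 M1(2) M3(2) M4(2) by blast
qed

end
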